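(* Let $a<b$ be real numbers, let $\alpha\in(1,2]$, $\beta\in[0,\alpha-1]$, and let $q\in C([a,b],\mathbb{R})$. Let $q_+(t)=\max\{q(t),0\}$ and assume $$\int_a^b q_+(t)\,dt\le\Gamma(\alpha)\left(\frac{2\alpha-2-\beta}{(b-a)(\alpha-1)}\right)^{\alpha-1}\left(\frac{2\alpha-2-\beta}{\alpha-1-\beta}\right)^{\alpha-1-\beta},$$ where for $\beta=\alpha-1$ the last factor is interpreted as $1$. Then the boundary value problem $$D_{a^+}^{\alpha}u+q(t)u=0,\quad t\in[a,b],\qquad u(a)=0,\quad D_{a^+}^{\beta}u(b)=0,$$ has no nontrivial solutions.
   Context: For $\nu>0$, the Riemann-Liouville fractional integral of order $\nu$ of $u:[a,b]\to\mathbb{R}$ is $I_{a^+}^{\nu}u(t)=\frac{1}{\Gamma(\nu)}\int_a^t(t-s)^{\nu-1}u(s)\,ds$, and $I_{a^+}^{0}u=u$. For a positive integer $n$ and $n-1<\gamma\le n$, the Riemann-Liouville fractional derivative of order $\gamma$ is $D_{a^+}^{\gamma}u(t)=\frac{d^n}{dt^n}I_{a^+}^{n-\gamma}u(t)$ (so for $\gamma=n$ it is the classical $n$-th derivative), and $D_{a^+}^{0}u=u$. Derivatives at the endpoints of $[a,b]$ are one-sided. A solution is a continuous function $u:[a,b]\to\mathbb{R}$ for which $D_{a^+}^{\alpha}u$ is defined on $[a,b]$ and which satisfies the equation on $[a,b]$ and the boundary conditions. Nontrivial means not identically zero. *)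

theory Defs
  imports "HOL-Analysis.Analysis"
begin

(* The case nu = 0 needs its own clause: the formula would give 0, as Gamma has a pole there. *)
definition rl_integral :: "real \<Rightarrow> real \<Rightarrow> (real \<Rightarrow> real) \<Rightarrow> real \<Rightarrow> real" where
  "rl_integral a \<nu> u t =
     (if \<nu> = 0 then u t
      else 1 / Gamma \<nu> * integral {a..t} (\<lambda>s. (t - s) powr (\<nu> - 1) * u s))"

(* "The n-th derivative of f relative to S exists at t and equals d".  As usual, existence at t
   only asks for the derivatives of lower order to exist in S near t.  For S = {a..b} the
   derivatives at the endpoints are one-sided, and values of f outside S play no role. *)
primrec has_nth_derivative_within ::
    "nat \<Rightarrow> real set \<Rightarrow> (real \<Rightarrow> real) \<Rightarrow> real \<Rightarrow> real \<Rightarrow> bool" where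
  "has_nth_derivative_within 0 S f t d \<longleftrightarrow> f t = d"
| "has_nth_derivative_within (Suc n) S f t d \<longleftrightarrow>
     (\<exists>g. (\<forall>\<^sub>F s in nhds t. s \<in> S \<longrightarrow> has_nth_derivative_within n S f s (g s)) \<and>
          (g has_real_derivative d) (at t within S))"

(* "The derivative of order gamma of u : [a,b] -> R is defined at t and equals d".
   For gamma \<ge> 0 the integer n with n - 1 < gamma \<le> n is the ceiling of gamma; for gamma = 0
   this gives n = 0 and the derivative is u itself. *)
definition has_rl_derivative ::
    "real \<Rightarrow> real \<Rightarrow> real \<Rightarrow> (real \<Rightarrow> real) \<Rightarrow> real \<Rightarrow> real \<Rightarrow> bool" where
  "has_rl_derivative a b \<gamma> u t d \<longleftrightarrow>
     (let n = nat \<lceil>\<gamma>\<rceil> in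
        has_nth_derivative_within n {a..b} (rl_integral a (real n - \<gamma>) u) t d)"

definition bvp_solution ::
    "real \<Rightarrow> real \<Rightarrow> real \<Rightarrow> real \<Rightarrow> (real \<Rightarrow> real) \<Rightarrow> (real \<Rightarrow> real) \<Rightarrow> bool" where
  "bvp_solution a b \<alpha> \<beta> q u \<longleftrightarrow>
     continuous_on {a..b} u \<and>
     (\<forall>t\<in>{a..b}. \<exists>d. has_rl_derivative a b \<alpha> u t d \<and> d + q t * u t = 0) \<and>
     u a = 0 \<and>
     has_rl_derivative a b \<beta> u b 0"

end

theory Submission
  imports Defs
begin

text \<open>
  Inverting the fractional derivative turns the boundary value problem into \<open>u = T (q u)\<close> (lemma
  \<open>bvp_solution_green_op\<close>) for the integral operator \<open>T = green_op\<close>, whose kernel \<open>G\<close> is nonnegative.  If \<open>q \<ge> 0\<close>, the claim is Lyapunov's argument: at a maximum of \<open>|u|\<close>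
  the inequality \<open>max |u| \<le> max |u| \<sqdot> max G \<sqdot> \<integral> q\<close> forces \<open>max G \<sqdot> \<integral> q \<ge> 1\<close>, strictly so since
  \<open>G\<close> attains its maximum at one point only.  The bound in the theorem is \<open>1 / max G\<close>.

  For a potential of variable sign one has to get rid of the negative part of \<open>q\<close>.  This is done by
  comparing \<open>u\<close> with \<open>v = T (q\<^sub>+ |u|) \<ge> 0\<close>.  The difference is \<open>u - v = T f\<close> with
  \<open>f = q u - q\<^sub>+ |u|\<close>, and \<open>f \<le> 0\<close> wherever \<open>u > v\<close>, because \<open>u > 0\<close> there.  The maximum principle
  (lemma \<open>green_op_maximum_principle\<close>) says that such a \<open>T f\<close> is nowhere positive.  So \<open>u \<le> v\<close>,
  likewise \<open>- u \<le> v\<close>, and \<open>|u| \<le> T (q\<^sub>+ |u|)\<close> lets Lyapunov's argument run with \<open>q\<^sub>+\<close> in place of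
  \<open>q\<close>.

  The maximum principle is the heart of the proof.  Positivity of \<open>G\<close> and the Weierstrass theorem
  reduce it to polynomials \<open>p\<close> that are negative wherever \<open>W = T p\<close> is positive.  Then \<open>W\<close> is smooth
  on the right of \<open>a\<close>.  Suppose it has a positive maximum \<open>m\<close> at \<open>c\<close>.  If \<open>c < b\<close>, look at the
  fractional integral \<open>F\<close> of \<open>W\<close> of order \<open>\<nu> = 2 - \<alpha>\<close>, which satisfies \<open>F'' = - p\<close>: its second
  differences at \<open>c\<close> are at least a positive multiple of \<open>h\<^sup>2\<close>.  But the constant \<open>m\<close> contributes a
  concave term to \<open>F\<close>, and \<open>m - W\<close> enters through the kernel \<open>x powr (\<nu> - 1)\<close>, which is convex
  except for its singularity at \<open>0\<close>; near there \<open>m - W = O(h\<^sup>2)\<close>, so the second differences are at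
  most \<open>O(h\<^sup>2 \<sqdot> h powr \<nu>)\<close>.  If \<open>c = b\<close>, the same reasoning with first differences shows that the
  fractional derivative of order \<open>\<beta>\<close> is positive at \<open>b\<close>, against the boundary condition.
\<close>

section \<open>The fractional integral of a continuous function\<close>

lemma has_integral_Beta_interval:
  fixes a t p \<mu> :: real
  assumes "0 < p" "0 < \<mu>" "a \<le> t"
  shows "((\<lambda>s. (t - s) powr (\<mu> - 1) * (s - a) powr (p - 1)) has_integral
           Beta p \<mu> * (t - a) powr (p + \<mu> - 1)) {a..t}"
proof (cases "a = t")
  case True
  then show ?thesis using has_integral_refl(2)[of _ t] by simp
next
  case False
  define T where "T = t - a"
  have T: "T > 0" using False assms by (simp add: T_def)
  have "((\<lambda>x. x powr (p - 1) * (1 - x) powr (\<mu> - 1)) has_integral Beta p \<mu>) (cbox 0 1)"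
    using has_integral_Beta_real[OF assms(1,2)] by simp
  note aff = has_integral_affinity'[OF this, of "1/T" "-a/T"]
  have "((\<lambda>s. (s / T - a / T) powr (p - 1) * (1 - (s / T - a / T)) powr (\<mu> - 1))
      has_integral Beta p \<mu> * T) {a..T + a}"
  proof -
    have e: "(0 - - a / T) /\<^sub>R (1 / T) = a" "(1 - - a / T) /\<^sub>R (1 / T) = T + a"
      using T by (simp_all add: field_simps)
    from aff T show ?thesis unfolding e by (simp add: mult.commute)
  qed
  then have "((\<lambda>s. T powr (p + \<mu> - 2) * ((s / T - a / T) powr (p - 1) * (1 - (s / T - a / T)) powr (\<mu> - 1)))
      has_integral T powr (p + \<mu> - 2) * (Beta p \<mu> * T)) {a..t}"
    by (intro has_integral_mult_right) (simp add: T_def)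
  moreover have "T powr (p + \<mu> - 2) * (Beta p \<mu> * T) = Beta p \<mu> * T powr (p + \<mu> - 1)"
    using T powr_add[of T "p + \<mu> - 2" 1] by simp
  moreover have "T powr (p + \<mu> - 2) * ((s / T - a / T) powr (p - 1) * (1 - (s / T - a / T)) powr (\<mu> - 1))
     = (t - s) powr (\<mu> - 1) * (s - a) powr (p - 1)" if "s \<in> {a..t}" for s
  proof -
    have t: "t = T + a" by (simp add: T_def)
    with T have 1: "s / T - a / T = (s - a) / T" "1 - (s / T - a / T) = (t - s) / T"
      by (simp_all add: field_simps)
    have "T powr (p + \<mu> - 2) = T powr (p - 1) * T powr (\<mu> - 1)"
      by (simp add: powr_add[symmetric])
    then show ?thesis using that T unfolding 1
      by (simp add: powr_divide t[symmetric] field_simps)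
  qed
  ultimately show ?thesis
    unfolding T_def[symmetric] using has_integral_cong by (metis (no_types, lifting))
qed

text \<open>
  This is not the instance \<open>p = 1\<close> of the Beta integral as it stands: the convention
  \<open>0 powr 0 = 0\<close> changes the value of the integrand at \<open>a\<close>.
\<close>
lemma rl_kernel_has_integral:
  fixes a t \<nu> :: real
  assumes "0 < \<nu>" "a \<le> t"
  shows "((\<lambda>s. (t - s) powr (\<nu> - 1)) has_integral (t - a) powr \<nu> / \<nu>) {a..t}"
proof -
  have B: "Beta 1 \<nu> = 1 / \<nu>"
    using assms by (simp add: Beta_def Gamma_plus1 add.commute) (metis Gamma_plus1 Gamma_eq_zero_iff
      add.commute nonpos_Ints_nonpos not_less mult.commute nonzero_divide_mult_cancel_left)
  have "((\<lambda>s. (t - s) powr (\<nu> - 1) * (s - a) powr (1 - 1)) has_integral (t - a) powr \<nu> / \<nu>) {a..t}"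
    using has_integral_Beta_interval[of 1 \<nu> a t] assms B by simp
  then show ?thesis
    by (rule has_integral_spike_finite[of "{a}", rotated 2]) auto
qed

lemma rl_kernel_absolutely_integrable:
  fixes a t \<nu> :: real
  assumes "0 < \<nu>" "a \<le> t" "continuous_on {a..t} f"
  shows "(\<lambda>s. (t - s) powr (\<nu> - 1) * f s) absolutely_integrable_on {a..t}"
proof -
  have "(\<lambda>s. (t - s) powr (\<nu> - 1)) absolutely_integrable_on {a..t}"
    using rl_kernel_has_integral[OF assms(1,2)]
    by (intro nonnegative_absolutely_integrable_1) auto
  moreover have "f \<in> borel_measurable (lebesgue_on {a..t})"
    using assms(3) by (intro continuous_imp_measurable_on_sets_lebesgue) auto
  moreover have "bounded (f ` {a..t})"
    using assms(3) compact_imp_bounded compact_continuous_image by blast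
  ultimately have "(\<lambda>s. f s * (t - s) powr (\<nu> - 1)) absolutely_integrable_on {a..t}"
    by (intro absolutely_integrable_bounded_measurable_product_real) auto
  then show ?thesis by (simp add: mult.commute)
qed

lemma rl_kernel_integrable:
  fixes a t \<nu> :: real
  assumes "0 < \<nu>" "a \<le> t" "continuous_on {a..t} f"
  shows "(\<lambda>s. (t - s) powr (\<nu> - 1) * f s) integrable_on {a..t}"
  using rl_kernel_absolutely_integrable[OF assms] set_lebesgue_integral_eq_integral(1) by blast

lemma rl_integral_pos:
  "0 < \<nu> \<Longrightarrow> rl_integral a \<nu> f t = 1 / Gamma \<nu> * integral {a..t} (\<lambda>s. (t - s) powr (\<nu> - 1) * f s)"
  by (simp add: rl_integral_def)

lemma rl_integral_0 [simp]: "rl_integral a 0 f = f"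
  by (simp add: rl_integral_def fun_eq_iff)

lemma rl_integral_start [simp]: "0 < \<nu> \<Longrightarrow> rl_integral a \<nu> f a = 0"
  by (simp add: rl_integral_def)

lemma rl_integral_cong:
  assumes "a \<le> t" "\<And>s. s \<in> {a..t} \<Longrightarrow> f s = g s"
  shows "rl_integral a \<nu> f t = rl_integral a \<nu> g t"
proof -
  have "integral {a..t} (\<lambda>s. (t - s) powr (\<nu> - 1) * f s) = integral {a..t} (\<lambda>s. (t - s) powr (\<nu> - 1) * g s)"
    by (rule Henstock_Kurzweil_Integration.integral_cong) (simp add: assms(2))
  then show ?thesis using assms by (simp add: rl_integral_def)
qed

lemma rl_integral_add:
  assumes "0 < \<nu>" "a \<le> t" "continuous_on {a..t} f" "continuous_on {a..t} g"
  shows "rl_integral a \<nu> (\<lambda>s. f s + g s) t = rl_integral a \<nu> f t + rl_integral a \<nu> g t"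
  using Henstock_Kurzweil_Integration.integral_add[OF rl_kernel_integrable[OF assms(1-3)] rl_kernel_integrable[OF assms(1,2,4)]]
  by (simp add: rl_integral_pos[OF assms(1)] distrib_left)

lemma rl_integral_cmult: "rl_integral a \<nu> (\<lambda>s. c * f s) t = c * rl_integral a \<nu> f t"
proof -
  have "integral {a..t} (\<lambda>s. (t - s) powr (\<nu> - 1) * (c * f s)) = c * integral {a..t} (\<lambda>s. (t - s) powr (\<nu> - 1) * f s)"
    unfolding Henstock_Kurzweil_Integration.integral_mult_right[symmetric] by (simp add: algebra_simps)
  then show ?thesis by (simp add: rl_integral_def)
qed

lemma rl_integral_diff:
  assumes "0 < \<nu>" "a \<le> t" "continuous_on {a..t} f" "continuous_on {a..t} g"
  shows "rl_integral a \<nu> (\<lambda>s. f s - g s) t = rl_integral a \<nu> f t - rl_integral a \<nu> g t"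
  using rl_integral_add[OF assms(1-3), of "\<lambda>s. (-1) * g s"] assms(4)
    rl_integral_cmult[of a \<nu> "-1" g t] by (simp add: continuous_on_minus)

lemma rl_integral_sum:
  assumes "0 < \<nu>" "a \<le> t" "finite S" "\<And>i. i \<in> S \<Longrightarrow> continuous_on {a..t} (f i)"
  shows "rl_integral a \<nu> (\<lambda>s. \<Sum>i\<in>S. f i s) t = (\<Sum>i\<in>S. rl_integral a \<nu> (f i) t)"
  using assms(3,4)
proof (induction S rule: finite_induct)
  case empty
  show ?case using rl_integral_cmult[of a \<nu> 0 "\<lambda>_. 0" t] by simp
next
  case (insert x S)
  then show ?case using assms(1,2)
    by (simp add: rl_integral_add continuous_on_sum)
qed

lemma rl_integral_mono:
  assumes "0 < \<nu>" "a \<le> t" "continuous_on {a..t} f" "continuous_on {a..t} g"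
    and "\<And>s. s \<in> {a..t} \<Longrightarrow> f s \<le> g s"
  shows "rl_integral a \<nu> f t \<le> rl_integral a \<nu> g t"
  unfolding rl_integral_pos[OF assms(1)]
  using assms
  by (intro mult_left_mono Henstock_Kurzweil_Integration.integral_le rl_kernel_integrable)
    (auto simp: less_imp_le Gamma_real_pos)

lemma rl_integral_powr:
  assumes "0 < \<nu>" "-1 < p" "a \<le> t"
  shows "rl_integral a \<nu> (\<lambda>s. (s - a) powr p) t = Gamma (p + 1) / Gamma (p + 1 + \<nu>) * (t - a) powr (p + \<nu>)"
proof -
  have "integral {a..t} (\<lambda>s. (t - s) powr (\<nu> - 1) * (s - a) powr p) = Beta (p + 1) \<nu> * (t - a) powr (p + \<nu>)"
    using has_integral_Beta_interval[of "p + 1" \<nu> a t] assms by (simp add: integral_unique)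
  moreover have "1 / y * (x * y / z * w) = x / z * w" if "y > 0" for x y z w :: real
    using that by simp
  ultimately show ?thesis
    using assms by (simp only: rl_integral_pos Beta_def Gamma_real_pos add_ac)
qed

lemma rl_integral_power:
  assumes "0 < \<nu>" "a \<le> t"
  shows "rl_integral a \<nu> (\<lambda>s. (s - a) ^ k) t = Gamma (real k + 1) / Gamma (real k + 1 + \<nu>) * (t - a) powr (real k + \<nu>)"
proof -
  have "integral {a..t} (\<lambda>s. (t - s) powr (\<nu> - 1) * (s - a) ^ k) = integral {a..t} (\<lambda>s. (t - s) powr (\<nu> - 1) * (s - a) powr (real k))"
    by (rule integral_spike[of "{a}"]) (auto simp: powr_realpow)
  then have "rl_integral a \<nu> (\<lambda>s. (s - a) ^ k) t = rl_integral a \<nu> (\<lambda>s. (s - a) powr (real k)) t"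
    using assms by (simp add: rl_integral_pos)
  then show ?thesis using assms by (simp add: rl_integral_powr)
qed

lemma rl_integral_const:
  assumes "0 < \<nu>" "a \<le> t"
  shows "rl_integral a \<nu> (\<lambda>_. c) t = c * (t - a) powr \<nu> / Gamma (\<nu> + 1)"
  using rl_integral_power[OF assms, of 0] rl_integral_cmult[of a \<nu> c "\<lambda>_. 1" t] by (simp add: add.commute)

lemma rl_integral_bound:
  assumes "0 < \<nu>" "a \<le> t" "continuous_on {a..t} f" "\<And>s. s \<in> {a..t} \<Longrightarrow> \<bar>f s\<bar> \<le> B"
  shows "\<bar>rl_integral a \<nu> f t\<bar> \<le> B * (t - a) powr \<nu> / Gamma (\<nu> + 1)"
proof -
  have "rl_integral a \<nu> f t \<le> rl_integral a \<nu> (\<lambda>_. B) t"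
    using assms by (intro rl_integral_mono) (auto simp: abs_le_iff)
  moreover have "rl_integral a \<nu> (\<lambda>_. - B) t \<le> rl_integral a \<nu> f t"
    using assms by (intro rl_integral_mono) (auto simp: abs_le_iff, smt (verit))
  ultimately show ?thesis using rl_integral_const[OF assms(1,2)] by (simp add: abs_le_iff)
qed

section \<open>Continuity and the semigroup law, by polynomial approximation\<close>

lemma shifted_polynomial_approx:
  fixes f :: "real \<Rightarrow> real"
  assumes "continuous_on {a..b} f" "0 < e"
  obtains c and n :: nat where "\<And>x. x \<in> {a..b} \<Longrightarrow> \<bar>f x - (\<Sum>i\<le>n. c i * (x - a) ^ i)\<bar> < e"
proof -
  have "continuous_on {0..b - a} (\<lambda>x. f (x + a))"
    by (intro continuous_on_compose2[OF assms(1)] continuous_intros) auto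
  then obtain g where g: "real_polynomial_function g" "\<And>x. x \<in> {0..b-a} \<Longrightarrow> \<bar>f (x + a) - g x\<bar> < e"
    using Stone_Weierstrass_real_polynomial_function[of "{0..b-a}"] assms(2) by (metis compact_Icc)
  then obtain c n where "g = (\<lambda>x. \<Sum>i\<le>n. c i * x ^ i)"
    using real_polynomial_function_iff_sum by blast
  with g(2)[of "x - a" for x] show thesis by (intro that[of c n]) auto
qed

lemma rl_integral_polynomial:
  assumes "0 < \<nu>" "a \<le> t"
  shows "rl_integral a \<nu> (\<lambda>s. \<Sum>i\<le>n. c i * (s - a) ^ i) t =
    (\<Sum>i\<le>n. c i * (Gamma (real i + 1) / Gamma (real i + 1 + \<nu>)) * (t - a) powr (real i + \<nu>))"
  using assms by (subst rl_integral_sum)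
    (auto simp: rl_integral_cmult rl_integral_power mult.assoc intro!: continuous_intros sum.cong)

lemma continuous_on_powr_shift:
  fixes p :: real assumes "0 < p"
  shows "continuous_on {a..b} (\<lambda>t. (t - a) powr p)"
  using assms by (intro continuous_on_powr' continuous_intros) auto

lemma powr_shift_mono:
  fixes a b t \<nu> :: real
  assumes "0 < \<nu>" "t \<in> {a..b}" 
  shows "(t - a) powr \<nu> \<le> (b - a) powr \<nu>"
  using assms by (intro powr_mono2) auto

text \<open>
  The fractional integral is bounded in the supremum norm, and it maps polynomials in \<open>t - a\<close> to
  sums of powers, so it maps uniform limits of polynomials to uniform limits of continuous functions.
\<close>
lemma continuous_on_rl_integral:
  assumes "0 < \<nu>" "continuous_on {a..b} f"
  shows "continuous_on {a..b} (rl_integral a \<nu> f)"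
proof -
  define M where "M = (b - a) powr \<nu> / Gamma (\<nu> + 1)"
  have "\<exists>g. continuous_on {a..b} g \<and> continuous_on {a..b} (rl_integral a \<nu> g) \<and> (\<forall>x\<in>{a..b}. \<bar>g x - f x\<bar> \<le> e)" if e: "e > 0" for e
  proof -
    obtain c n where cn: "\<And>x. x \<in> {a..b} \<Longrightarrow> \<bar>f x - (\<Sum>i\<le>n. c i * (x - a) ^ i)\<bar> < e"
      using shifted_polynomial_approx[OF assms(2) e] by metis
    let ?g = "\<lambda>x. \<Sum>i\<le>n. c i * (x - a) ^ i"
    have "continuous_on {a..b} (rl_integral a \<nu> ?g) \<longleftrightarrow>
       continuous_on {a..b} (\<lambda>t. \<Sum>i\<le>n. c i * (Gamma (real i + 1) / Gamma (real i + 1 + \<nu>)) * (t - a) powr (real i + \<nu>))"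
      by (intro continuous_on_cong) (auto simp: rl_integral_polynomial assms(1))
    also have "\<dots>" using assms(1) by (intro continuous_intros continuous_on_powr_shift) auto
    finally show ?thesis using cn
      by (intro exI[of _ ?g]) (force intro!: continuous_intros simp: abs_minus_commute less_imp_le)
  qed
  then obtain G where G: "\<And>e. e > 0 \<Longrightarrow> continuous_on {a..b} (G e)"
     "\<And>e. e > 0 \<Longrightarrow> continuous_on {a..b} (rl_integral a \<nu> (G e))"
     "\<And>e x. e > 0 \<Longrightarrow> x \<in> {a..b} \<Longrightarrow> \<bar>G e x - f x\<bar> \<le> e"
    by metis
  have 1: "\<forall>\<^sub>F e in at_right (0::real). continuous_on {a..b} (rl_integral a \<nu> (G e))"
    using G(2) by (auto simp: eventually_at_right_less intro: eventually_at_rightI[of 0 1])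
  have M: "M \<ge> 0" using assms(1) by (simp add: M_def Gamma_real_pos less_imp_le)
  have bd: "\<bar>rl_integral a \<nu> (G e) x - rl_integral a \<nu> f x\<bar> \<le> e * M" if "e > 0" "x \<in> {a..b}" for e x
  proof -
    have c: "continuous_on {a..x} (G e)" "continuous_on {a..x} f"
      using G(1)[OF that(1)] assms(2) that(2) by (auto elim: continuous_on_subset)
    have "\<bar>rl_integral a \<nu> (\<lambda>s. G e s - f s) x\<bar> \<le> e * (x - a) powr \<nu> / Gamma (\<nu> + 1)"
      using that G(3) c assms(1) by (intro rl_integral_bound continuous_intros) auto
    also have "\<dots> \<le> e * M" unfolding M_def times_divide_eq_right
      using powr_shift_mono[OF assms(1) that(2)] that(1) assms(1)
      by (intro divide_right_mono mult_left_mono) (auto simp: Gamma_real_pos less_imp_le)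
    finally show ?thesis using rl_integral_diff[of \<nu> a x "G e" f] c that assms(1) by simp
  qed
  have "uniform_limit {a..b} (\<lambda>e. rl_integral a \<nu> (G e)) (rl_integral a \<nu> f) (at_right 0)"
  proof (rule uniform_limitI)
    fix d :: real assume "d > 0"
    show "\<forall>\<^sub>F e in at_right 0. \<forall>x\<in>{a..b}. dist (rl_integral a \<nu> (G e) x) (rl_integral a \<nu> f x) < d"
    proof (rule eventually_at_rightI[of 0 "d / (M + 1)"])
      fix e assume e: "e \<in> {0<..<d / (M + 1)}"
      then have "e * (M + 1) < d" using M by (simp add: field_simps)
      then have "e * M < d" using e by (simp add: algebra_simps)
      then show "\<forall>x\<in>{a..b}. dist (rl_integral a \<nu> (G e) x) (rl_integral a \<nu> f x) < d"
        using bd[of e] e by (force simp: dist_real_def)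
    qed (use \<open>d > 0\<close> M in auto)
  qed
  from uniform_limit_theorem[OF 1 this] show ?thesis by simp
qed

text \<open>
  On powers the law is an identity between Gamma values.  Both sides are bounded in the supremum norm
  of \<open>f\<close>, so the Weierstrass theorem carries it over to continuous functions; this replaces an
  exchange of the order of integration under two singular kernels.
\<close>
lemma rl_integral_semigroup:
  assumes "0 < \<mu>" "0 < \<nu>" "continuous_on {a..b} f" "t \<in> {a..b}"
  shows "rl_integral a \<mu> (rl_integral a \<nu> f) t = rl_integral a (\<mu> + \<nu>) f t"
proof -
  \<comment> \<open>Bounds for the operator norms of the two sides.\<close>
  define M where "M = (b - a) powr \<nu> / Gamma (\<nu> + 1) * (b - a) powr \<mu> / Gamma (\<mu> + 1)
      + (b - a) powr (\<mu> + \<nu>) / Gamma (\<mu> + \<nu> + 1)"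
  have G: "Gamma (\<nu> + 1) > 0" "Gamma (\<mu> + 1) > 0" "Gamma (\<mu> + \<nu> + 1) > 0"
    using assms by (auto intro!: Gamma_real_pos)
  have at: "a \<le> t" using assms by simp
  have sub: "continuous_on {a..s} g" if "continuous_on {a..b} g" "s \<in> {a..b}" for g :: "real \<Rightarrow> real" and s
    using that by (auto elim: continuous_on_subset)
  have "\<bar>rl_integral a \<mu> (rl_integral a \<nu> f) t - rl_integral a (\<mu> + \<nu>) f t\<bar> \<le> e * M" if e: "e > 0" for e
  proof -
    obtain c n where cn: "\<And>x. x \<in> {a..b} \<Longrightarrow> \<bar>f x - (\<Sum>i\<le>n. c i * (x - a) ^ i)\<bar> < e"
      using shifted_polynomial_approx[OF assms(3) e] by metis
    define g where "g = (\<lambda>x. \<Sum>i\<le>n. c i * (x - a) ^ i)"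
    have g: "continuous_on {a..b} g" unfolding g_def by (intro continuous_intros)
    have fg: "continuous_on {a..b} (\<lambda>x. f x - g x)" by (intro continuous_intros g assms)
    have fge: "\<bar>f x - g x\<bar> \<le> e" if "x \<in> {a..b}" for x
      using cn[OF that] by (simp add: g_def)
    have gg: "rl_integral a \<mu> (rl_integral a \<nu> g) t = rl_integral a (\<mu> + \<nu>) g t"
    proof -
      have "rl_integral a \<mu> (rl_integral a \<nu> g) t = rl_integral a \<mu>
         (\<lambda>t. \<Sum>i\<le>n. c i * (Gamma (real i + 1) / Gamma (real i + 1 + \<nu>)) * (t - a) powr (real i + \<nu>)) t"
        using assms at by (intro rl_integral_cong) (auto simp: rl_integral_polynomial g_def)
      also have "\<dots> = (\<Sum>i\<le>n. c i * (Gamma (real i + 1) / Gamma (real i + 1 + \<nu>)) * rl_integral a \<mu> (\<lambda>t. (t - a) powr (real i + \<nu>)) t)"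
        using assms at unfolding rl_integral_cmult[symmetric]
        by (intro rl_integral_sum) (auto simp del: times_divide_eq_left times_divide_eq_right
          intro!: continuous_on_mult_left continuous_on_powr_shift)
      also have "\<dots> = rl_integral a (\<mu> + \<nu>) g t"
        unfolding g_def using assms at
      proof (subst rl_integral_polynomial, simp, simp, intro sum.cong refl)
        fix i assume "i \<in> {..n}"
        have A: "Gamma (real i + 1 + \<nu>) > 0" using assms by (intro Gamma_real_pos) auto
        have B: "x * (z / y) * (y / v * w) = x * (z / v) * w" if "y > 0" for x y z v w :: real
          using that by simp
        have C: "rl_integral a \<mu> (\<lambda>t. (t - a) powr (real i + \<nu>)) t =
            Gamma (real i + 1 + \<nu>) / Gamma (real i + 1 + (\<mu> + \<nu>)) * (t - a) powr (real i + (\<mu> + \<nu>))"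
        proof -
          have e: "real i + \<nu> + 1 = real i + 1 + \<nu>" "real i + 1 + \<nu> + \<mu> = real i + 1 + (\<mu> + \<nu>)"
            "real i + \<nu> + \<mu> = real i + (\<mu> + \<nu>)" by simp_all
          have "-1 < real i + \<nu>" using assms(2) by simp
          from rl_integral_powr[OF assms(1) this at] show ?thesis unfolding e .
        qed
        show "c i * (Gamma (real i + 1) / Gamma (real i + 1 + \<nu>)) * rl_integral a \<mu> (\<lambda>t. (t - a) powr (real i + \<nu>)) t
          = c i * (Gamma (real i + 1) / Gamma (real i + 1 + (\<mu> + \<nu>))) * (t - a) powr (real i + (\<mu> + \<nu>))"
          unfolding C by (rule B[OF A])
      qed
      finally show ?thesis .
    qed
    have Ifg: "continuous_on {a..b} (rl_integral a \<nu> f)" "continuous_on {a..b} (rl_integral a \<nu> g)"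
      using assms g by (auto intro: continuous_on_rl_integral)
    have d1: "rl_integral a \<nu> f s - rl_integral a \<nu> g s = rl_integral a \<nu> (\<lambda>x. f x - g x) s" if "s \<in> {a..b}" for s
      using that assms(2) by (intro rl_integral_diff[symmetric] sub[OF g] sub[OF assms(3)]) auto
    have b1: "\<bar>rl_integral a \<nu> (\<lambda>x. f x - g x) s\<bar> \<le> e * ((b - a) powr \<nu> / Gamma (\<nu> + 1))" if s: "s \<in> {a..b}" for s
    proof -
      have "\<bar>rl_integral a \<nu> (\<lambda>x. f x - g x) s\<bar> \<le> e * (s - a) powr \<nu> / Gamma (\<nu> + 1)"
        using s assms(2) by (intro rl_integral_bound sub[OF fg] fge) auto
      also have "\<dots> \<le> e * ((b - a) powr \<nu> / Gamma (\<nu> + 1))" unfolding times_divide_eq_right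
        using powr_shift_mono[OF assms(2) s] \<open>e > 0\<close> G
        by (intro divide_right_mono mult_left_mono) (auto simp: less_imp_le)
      finally show ?thesis .
    qed
    have "rl_integral a \<mu> (rl_integral a \<nu> f) t - rl_integral a \<mu> (rl_integral a \<nu> g) t
        = rl_integral a \<mu> (\<lambda>s. rl_integral a \<nu> f s - rl_integral a \<nu> g s) t"
      using assms(1,4) by (intro rl_integral_diff[symmetric] sub[OF Ifg(1)] sub[OF Ifg(2)]) auto
    also have "\<bar>\<dots>\<bar> \<le> e * ((b - a) powr \<nu> / Gamma (\<nu> + 1)) * (t - a) powr \<mu> / Gamma (\<mu> + 1)"
    proof (rule rl_integral_bound[OF assms(1) at])
      show "continuous_on {a..t} (\<lambda>s. rl_integral a \<nu> f s - rl_integral a \<nu> g s)"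
        using assms(4) by (intro continuous_on_diff sub[OF Ifg(1)] sub[OF Ifg(2)])
      show "\<bar>rl_integral a \<nu> f s - rl_integral a \<nu> g s\<bar> \<le> e * ((b - a) powr \<nu> / Gamma (\<nu> + 1))" if "s \<in> {a..t}" for s
        using d1[of s] b1[of s] that assms(4) by simp
    qed
    also have "\<dots> \<le> e * ((b - a) powr \<nu> / Gamma (\<nu> + 1)) * (b - a) powr \<mu> / Gamma (\<mu> + 1)"
      using powr_shift_mono[OF assms(1,4)] G \<open>e > 0\<close>
      by (intro divide_right_mono mult_left_mono) (auto intro!: mult_nonneg_nonneg divide_nonneg_pos)
    finally have 1: "\<bar>rl_integral a \<mu> (rl_integral a \<nu> f) t - rl_integral a \<mu> (rl_integral a \<nu> g) t\<bar>
        \<le> e * ((b - a) powr \<nu> / Gamma (\<nu> + 1)) * (b - a) powr \<mu> / Gamma (\<mu> + 1)" .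
    have "rl_integral a (\<mu> + \<nu>) f t - rl_integral a (\<mu> + \<nu>) g t = rl_integral a (\<mu> + \<nu>) (\<lambda>x. f x - g x) t"
      using assms(1,2,4) by (intro rl_integral_diff[symmetric] sub[OF g] sub[OF assms(3)]) auto
    also have "\<bar>\<dots>\<bar> \<le> e * (t - a) powr (\<mu> + \<nu>) / Gamma (\<mu> + \<nu> + 1)"
      using assms by (intro rl_integral_bound sub[OF fg] fge) auto
    also have "\<dots> \<le> e * (b - a) powr (\<mu> + \<nu>) / Gamma (\<mu> + \<nu> + 1)"
      using powr_shift_mono[of "\<mu> + \<nu>" t a b] assms G \<open>e > 0\<close>
      by (intro divide_right_mono mult_left_mono) (auto simp: less_imp_le)
    finally have "\<bar>rl_integral a (\<mu> + \<nu>) f t - rl_integral a (\<mu> + \<nu>) g t\<bar>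
        \<le> e * (b - a) powr (\<mu> + \<nu>) / Gamma (\<mu> + \<nu> + 1)" .
    with 1 gg show ?thesis unfolding M_def by (simp add: algebra_simps)
  qed
  note * = this
  have "M \<ge> 0" unfolding M_def using G by (simp add: less_imp_le)
  have "\<bar>rl_integral a \<mu> (rl_integral a \<nu> f) t - rl_integral a (\<mu> + \<nu>) f t\<bar> \<le> 0"
  proof (rule field_le_epsilon)
    fix e :: real assume "e > 0"
    have "e / (M + 1) * M \<le> e" using \<open>M \<ge> 0\<close> \<open>e > 0\<close> by (simp add: field_simps)
    with *[of "e / (M + 1)"] \<open>M \<ge> 0\<close> \<open>e > 0\<close>
    show "\<bar>rl_integral a \<mu> (rl_integral a \<nu> f) t - rl_integral a (\<mu> + \<nu>) f t\<bar> \<le> 0 + e" by simp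
  qed
  then show ?thesis by simp
qed

lemma rl_integral_1: "rl_integral a 1 f t = integral {a..t} f"
proof -
  have "integral {a..t} (\<lambda>s. (t - s) powr (1 - 1) * f s) = integral {a..t} f"
    by (rule integral_spike[of "{t}"]) auto
  then show ?thesis by (simp add: rl_integral_def)
qed

lemma rl_integral_Suc_deriv:
  assumes "0 \<le> \<nu>" "continuous_on {a..b} f" "t \<in> {a..b}"
  shows "(rl_integral a (\<nu> + 1) f has_real_derivative rl_integral a \<nu> f t) (at t within {a..b})"
proof -
  have "(rl_integral a 1 (rl_integral a \<nu> f) has_real_derivative rl_integral a \<nu> f t) (at t within {a..b})"
  proof -
    have c: "continuous_on {a..b} (rl_integral a \<nu> f)"
    proof (cases "\<nu> = 0")
      case True
      then have "rl_integral a \<nu> f = f" by (auto simp: rl_integral_def)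
      with assms show ?thesis by simp
    qed (use assms continuous_on_rl_integral[of \<nu> a b f] in simp)
    have "rl_integral a 1 (rl_integral a \<nu> f) = (\<lambda>x. integral {a..x} (rl_integral a \<nu> f))"
      by (auto simp: rl_integral_1)
    with integral_has_real_derivative[OF c assms(3)] show ?thesis by simp
  qed
  moreover have "rl_integral a 1 (rl_integral a \<nu> f) x = rl_integral a (\<nu> + 1) f x" if "x \<in> {a..b}" for x
  proof (cases "\<nu> = 0")
    case True
    then have "rl_integral a \<nu> f = f" by (auto simp: rl_integral_def)
    with True show ?thesis by simp
  next
    case False
    then show ?thesis using rl_integral_semigroup[of 1 \<nu> a b f x] assms that by (simp add: add.commute)
  qed
  ultimately show ?thesis
    using assms(3) by (auto intro: has_field_derivative_transform_within[of _ _ _ _ 1])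
qed

section \<open>Integral form of the boundary value problem\<close>

text \<open>
  Every function considered below has the two-term form \<open>c (t - a)\<^bsup>\<alpha>-1\<^esup> - I\<^sup>\<alpha> h\<close>: the general
  continuous solution of \<open>D\<^sup>\<alpha> u = - h\<close> that vanishes at \<open>a\<close>.
\<close>
lemma rl_integral_two_term:
  assumes "1 < \<alpha>" "0 \<le> \<nu>" "continuous_on {a..b} h" "t \<in> {a..b}"
  shows "rl_integral a \<nu> (\<lambda>t. c * (t - a) powr (\<alpha> - 1) - rl_integral a \<alpha> h t) t
    = c * Gamma \<alpha> / Gamma (\<alpha> + \<nu>) * (t - a) powr (\<alpha> - 1 + \<nu>) - rl_integral a (\<alpha> + \<nu>) h t"
proof (cases "\<nu> = 0")
  case True
  have "Gamma \<alpha> > 0" using assms by (simp add: Gamma_real_pos)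
  then have "c * Gamma \<alpha> / Gamma \<alpha> = c" by (metis less_irrefl nonzero_mult_div_cancel_right)
  then show ?thesis using True by simp
next
  case False
  then have \<nu>: "\<nu> > 0" using assms by simp
  have sub: "continuous_on {a..t} (rl_integral a \<alpha> h)"
    using continuous_on_rl_integral[of \<alpha> a b h] assms by (auto elim: continuous_on_subset)
  have "rl_integral a \<nu> (\<lambda>t. c * (t - a) powr (\<alpha> - 1) - rl_integral a \<alpha> h t) t
     = rl_integral a \<nu> (\<lambda>t. c * (t - a) powr (\<alpha> - 1)) t - rl_integral a \<nu> (rl_integral a \<alpha> h) t"
    using \<nu> assms sub by (intro rl_integral_diff continuous_on_mult_left continuous_on_powr_shift) auto
  also have "rl_integral a \<nu> (rl_integral a \<alpha> h) t = rl_integral a (\<alpha> + \<nu>) h t"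
    using rl_integral_semigroup[of \<nu> \<alpha> a b h t] \<nu> assms by (simp add: add.commute)
  also have "rl_integral a \<nu> (\<lambda>t. c * (t - a) powr (\<alpha> - 1)) t
      = c * Gamma \<alpha> / Gamma (\<alpha> + \<nu>) * (t - a) powr (\<alpha> - 1 + \<nu>)"
    using rl_integral_powr[of \<nu> "\<alpha> - 1" a t] \<nu> assms by (simp add: rl_integral_cmult)
  finally show ?thesis .
qed

text \<open>
  Abel's inversion: a fractional integration of complementary order gives the ordinary integral of
  \<open>f\<close>, which determines \<open>f\<close>.
\<close>
lemma rl_integral_injective:
  assumes "0 \<le> \<nu>" "\<nu> < 1" "continuous_on {a..b} f" "a < b"
    and "\<And>t. t \<in> {a..b} \<Longrightarrow> rl_integral a \<nu> f t = 0" and "t \<in> {a..b}"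
  shows "f t = 0"
proof -
  have 0: "rl_integral a 1 f s = 0" if "s \<in> {a..b}" for s
  proof -
    have "rl_integral a (1 - \<nu>) (rl_integral a \<nu> f) s = rl_integral a 1 f s"
      using rl_integral_semigroup[of "1 - \<nu>" \<nu> a b f s] assms that by (cases "\<nu> = 0") auto
    moreover have "rl_integral a (1 - \<nu>) (rl_integral a \<nu> f) s = rl_integral a (1 - \<nu>) (\<lambda>_. 0 * 0) s"
      using assms that by (intro rl_integral_cong) auto
    ultimately show ?thesis using assms(2) by (simp only: rl_integral_cmult)
  qed
  have "(rl_integral a 1 f has_real_derivative f t) (at t within {a..b})"
    using rl_integral_Suc_deriv[of 0 a b f t] assms by simp
  moreover have "(rl_integral a 1 f has_real_derivative 0) (at t within {a..b})"
    by (rule has_field_derivative_transform_within[of "\<lambda>_. 0" _ _ _ 1]) (use 0 assms in auto)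
  ultimately show ?thesis
    using vector_derivative_unique_within_closed_interval[of a b t "rl_integral a 1 f" "f t" 0] assms
    by (auto simp: has_real_derivative_iff_has_vector_derivative)
qed

lemma has_nth_derivative_within_oneD:
  assumes "has_nth_derivative_within (Suc 0) S f t d" "t \<in> S"
  shows "(f has_real_derivative d) (at t within S)"
proof -
  obtain g where g: "\<forall>\<^sub>F s in nhds t. s \<in> S \<longrightarrow> f s = g s" "(g has_real_derivative d) (at t within S)"
    using assms by auto
  have "g t = f t" using eventually_nhds_x_imp_x[OF g(1)] assms by simp
  moreover have "\<forall>\<^sub>F s in at t within S. g s = f s"
    using g(1) unfolding eventually_at_filter by eventually_elim auto
  ultimately show ?thesis
    using g(2) has_field_derivative_cong_eventually by blast
qed

text \<open>
  The definition of higher derivatives offers a separate first derivative near each point.  On a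
  nondegenerate interval derivatives are unique, so these local choices agree with a single function.
\<close>
lemma second_derivative_within_antiderivative:
  assumes "a < b" "continuous_on {a..b} h"
    and "\<And>t. t \<in> {a..b} \<Longrightarrow> has_nth_derivative_within (Suc (Suc 0)) {a..b} F t (- h t)"
  obtains k where "\<And>t. t \<in> {a..b} \<Longrightarrow> F t = F a + k * (t - a) - rl_integral a 2 h t"
proof -
  define F1 where "F1 t = (SOME d. (F has_real_derivative d) (at t within {a..b}))" for t
  have uniq: "d = e" if "(G has_real_derivative d) (at t within {a..b})"
    "(G has_real_derivative e) (at t within {a..b})" "t \<in> {a..b}" for G d e t
    using vector_derivative_unique_within_closed_interval[of a b t G d e] assms that
    by (auto simp: has_real_derivative_iff_has_vector_derivative)
  have F: "(F has_real_derivative F1 t) (at t within {a..b}) \<and> (F1 has_real_derivative - h t) (at t within {a..b})"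
    if t: "t \<in> {a..b}" for t
  proof -
    obtain g where g: "\<forall>\<^sub>F s in nhds t. s \<in> {a..b} \<longrightarrow> has_nth_derivative_within (Suc 0) {a..b} F s (g s)"
      "(g has_real_derivative - h t) (at t within {a..b})"
      using assms(3)[OF t] by (auto simp del: has_nth_derivative_within.simps(1))
    have "\<forall>\<^sub>F s in nhds t. s \<in> {a..b} \<longrightarrow> (F has_real_derivative g s) (at s within {a..b})"
      using g(1) by eventually_elim (use has_nth_derivative_within_oneD in blast)
    then have ev: "\<forall>\<^sub>F s in nhds t. s \<in> {a..b} \<longrightarrow> (F has_real_derivative F1 s) (at s within {a..b}) \<and> F1 s = g s"
    proof eventually_elim
      case (elim s)
      show ?case
      proof
        assume s: "s \<in> {a..b}"
        with elim have "(F has_real_derivative g s) (at s within {a..b})" by simp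
        moreover from this have "(F has_real_derivative F1 s) (at s within {a..b})"
          unfolding F1_def by (rule someI)
        ultimately show "(F has_real_derivative F1 s) (at s within {a..b}) \<and> F1 s = g s"
          using uniq s by blast
      qed
    qed
    have 1: "(F has_real_derivative F1 t) (at t within {a..b})" "g t = F1 t"
      using eventually_nhds_x_imp_x[OF ev] t by auto
    have "\<forall>\<^sub>F s in at t within {a..b}. g s = F1 s"
      using ev unfolding eventually_at_filter by eventually_elim auto
    with g(2) 1 show ?thesis using has_field_derivative_cong_eventually by blast
  qed
  have const: "\<exists>c. \<forall>t\<in>{a..b}. G t = c" if "\<And>t. t \<in> {a..b} \<Longrightarrow> (G has_real_derivative 0) (at t within {a..b})" for G
    using has_field_derivative_zero_constant[of "{a..b}" G] that by auto
  have "\<exists>c. \<forall>t\<in>{a..b}. F1 t + rl_integral a 1 h t = c"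
    using F rl_integral_Suc_deriv[of 0 a b h] assms(2)
    by (intro const) (auto intro!: derivative_eq_intros)
  then obtain k where k: "F1 t + rl_integral a 1 h t = k" if "t \<in> {a..b}" for t by auto
  have "\<exists>c. \<forall>t\<in>{a..b}. F t + rl_integral a 2 h t - k * (t - a) = c"
  proof (intro const)
    fix t assume t: "t \<in> {a..b}"
    show "((\<lambda>t. F t + rl_integral a 2 h t - k * (t - a)) has_real_derivative 0) (at t within {a..b})"
      using F[OF t] rl_integral_Suc_deriv[of 1 a b h t] assms(2) t k[OF t]
      by (auto intro!: derivative_eq_intros)
  qed
  then obtain c where c: "F t + rl_integral a 2 h t - k * (t - a) = c" if "t \<in> {a..b}" for t by auto
  show thesis using c c[of a] assms(1) by (intro that[of k]) (auto simp: algebra_simps)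
qed

text \<open>
  The equation says that \<open>I\<^sup>2\<^sup>-\<^sup>\<alpha> u\<close> has second derivative \<open>- h\<close>; it vanishes at \<open>a\<close>, so it is
  \<open>k (t - a) - I\<^sup>2 h\<close>.  A two-term function with the right constant has the same fractional integral,
  and injectivity identifies it with \<open>u\<close>.
\<close>
lemma rl_equation_representation:
  assumes "a < b" "1 < \<alpha>" "\<alpha> \<le> 2" "continuous_on {a..b} u" "continuous_on {a..b} h" "u a = 0"
    and "\<And>t. t \<in> {a..b} \<Longrightarrow> has_rl_derivative a b \<alpha> u t (- h t)"
  obtains c where "\<And>t. t \<in> {a..b} \<Longrightarrow> u t = c * (t - a) powr (\<alpha> - 1) - rl_integral a \<alpha> h t"
proof -
  have "\<lceil>\<alpha>\<rceil> = 2" using assms by (simp add: ceiling_eq_iff)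
  then have n: "nat \<lceil>\<alpha>\<rceil> = Suc (Suc 0)" by simp
  have "has_nth_derivative_within (Suc (Suc 0)) {a..b} (rl_integral a (2 - \<alpha>) u) t (- h t)" if "t \<in> {a..b}" for t
    using assms(7)[OF that] by (simp add: has_rl_derivative_def n Let_def del: has_nth_derivative_within.simps)
  from second_derivative_within_antiderivative[OF assms(1,5) this] obtain k where
    k: "\<And>t. t \<in> {a..b} \<Longrightarrow> rl_integral a (2 - \<alpha>) u t = rl_integral a (2 - \<alpha>) u a + k * (t - a) - rl_integral a 2 h t"
    by blast
  have a0: "rl_integral a (2 - \<alpha>) u a = 0"
    using assms by (cases "\<alpha> = 2") auto
  define c where "c = k / Gamma \<alpha>"
  have "Gamma \<alpha> > 0" using assms by (simp add: Gamma_real_pos)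
  then have ck: "c * Gamma \<alpha> = k" by (simp add: c_def)
  define v where "v = (\<lambda>t. c * (t - a) powr (\<alpha> - 1) - rl_integral a \<alpha> h t)"
  have v: "continuous_on {a..b} v" unfolding v_def using assms
    by (intro continuous_on_diff continuous_on_mult_left continuous_on_powr_shift continuous_on_rl_integral) auto
  have Iv: "rl_integral a (2 - \<alpha>) v t = rl_integral a (2 - \<alpha>) u t" if t: "t \<in> {a..b}" for t
  proof -
    have "rl_integral a (2 - \<alpha>) v t = k / Gamma 2 * (t - a) powr 1 - rl_integral a 2 h t"
      using rl_integral_two_term[of \<alpha> "2 - \<alpha>" a b h t c] assms t ck by (simp add: v_def)
    moreover have "Gamma 2 = (1::real)" using Gamma_fact[of 1, where ?'a = real] by simp
    ultimately show ?thesis using k[OF t] a0 t by simp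
  qed
  have "u t - v t = 0" if "t \<in> {a..b}" for t
  proof (rule rl_integral_injective[of "2 - \<alpha>" a b "\<lambda>t. u t - v t" t])
    fix s assume s: "s \<in> {a..b}"
    show "rl_integral a (2 - \<alpha>) (\<lambda>t. u t - v t) s = 0"
    proof (cases "\<alpha> = 2")
      case False
      then show ?thesis using Iv[OF s] s assms v
        by (subst rl_integral_diff) (auto elim: continuous_on_subset)
    qed (use Iv[OF s] in simp)
  qed (use assms v that in \<open>auto intro!: continuous_intros\<close>)
  then show thesis by (intro that[of c]) (auto simp: v_def)
qed

text \<open>
  For \<open>0 < \<beta> \<le> 1\<close> the derivative on the left is \<open>D\<^sup>\<beta> u\<close>.  At \<open>t = b\<close> the formula determines \<open>c\<close> from the
  boundary condition, and conversely shows that \<open>green_op\<close>, defined below, satisfies it.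
\<close>
lemma two_term_derivative:
  assumes "1 < \<alpha>" "\<beta> \<le> 1" "\<beta> \<le> \<alpha> - 1" "continuous_on {a..b} h" "t \<in> {a<..b}"
    and "\<And>t. t \<in> {a..b} \<Longrightarrow> u t = c * (t - a) powr (\<alpha> - 1) - rl_integral a \<alpha> h t"
  shows "(rl_integral a (1 - \<beta>) u has_real_derivative
     c * Gamma \<alpha> / Gamma (\<alpha> - \<beta>) * (t - a) powr (\<alpha> - 1 - \<beta>) - rl_integral a (\<alpha> - \<beta>) h t) (at t within {a..b})"
proof -
  have G: "Gamma (\<alpha> + 1 - \<beta>) = (\<alpha> - \<beta>) * Gamma (\<alpha> - \<beta>)"
  proof -
    have "\<alpha> - \<beta> \<notin> \<int>\<^sub>\<le>\<^sub>0" using assms nonpos_Ints_nonpos[of "\<alpha> - \<beta>"] by fastforce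
    then show ?thesis using Gamma_plus1[of "\<alpha> - \<beta>"] by (simp add: algebra_simps)
  qed
  have eq: "rl_integral a (1 - \<beta>) u s =
      c * Gamma \<alpha> / Gamma (\<alpha> + 1 - \<beta>) * (s - a) powr (\<alpha> - \<beta>) - rl_integral a (\<alpha> - \<beta> + 1) h s" if "s \<in> {a..b}" for s
  proof -
    have "rl_integral a (1 - \<beta>) u s = rl_integral a (1 - \<beta>) (\<lambda>t. c * (t - a) powr (\<alpha> - 1) - rl_integral a \<alpha> h t) s"
      using that assms by (intro rl_integral_cong) auto
    then show ?thesis using rl_integral_two_term[of \<alpha> "1 - \<beta>" a b h s c] that assms
      by (simp add: algebra_simps)
  qed
  have "((\<lambda>s. c * Gamma \<alpha> / Gamma (\<alpha> + 1 - \<beta>) * (s - a) powr (\<alpha> - \<beta>) - rl_integral a (\<alpha> - \<beta> + 1) h s)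
     has_real_derivative
     c * Gamma \<alpha> / Gamma (\<alpha> + 1 - \<beta>) * ((\<alpha> - \<beta>) * (t - a) powr (\<alpha> - \<beta> - 1)) - rl_integral a (\<alpha> - \<beta>) h t) (at t within {a..b})"
    using assms rl_integral_Suc_deriv[of "\<alpha> - \<beta>" a b h t]
    by (intro DERIV_diff DERIV_cmult) (auto intro!: derivative_eq_intros)
  moreover have "c * Gamma \<alpha> / Gamma (\<alpha> + 1 - \<beta>) * ((\<alpha> - \<beta>) * (t - a) powr (\<alpha> - \<beta> - 1))
     = c * Gamma \<alpha> / Gamma (\<alpha> - \<beta>) * (t - a) powr (\<alpha> - 1 - \<beta>)"
  proof -
    have "x / (y * z) * (y * w) = x / z * w" if "y > 0" for x y z w :: real
      using that by simp
    moreover have "\<alpha> - \<beta> - 1 = \<alpha> - 1 - \<beta>" by simp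
    moreover have "\<alpha> - \<beta> > 0" using assms by simp
    ultimately show ?thesis unfolding G by metis
  qed
  ultimately show ?thesis
    using eq assms(5) by (auto intro: has_field_derivative_transform_within[of _ _ _ _ 1])
qed

text \<open>
  The coefficient \<open>c\<close> for which \<open>c (t - a)\<^bsup>\<alpha>-1\<^esup> - I\<^sup>\<alpha> f\<close> satisfies \<open>D\<^sup>\<beta> u(b) = 0\<close>.
\<close>
definition bvp_const :: "real \<Rightarrow> real \<Rightarrow> real \<Rightarrow> real \<Rightarrow> (real \<Rightarrow> real) \<Rightarrow> real" where
  "bvp_const a b \<alpha> \<beta> f = Gamma (\<alpha> - \<beta>) / Gamma \<alpha> * rl_integral a (\<alpha> - \<beta>) f b / (b - a) powr (\<alpha> - 1 - \<beta>)"

text \<open>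
  The solution of \<open>D\<^sup>\<alpha> u = - f\<close> under both boundary conditions, that is, the integral operator whose
  kernel is the Green function.
\<close>
definition green_op :: "real \<Rightarrow> real \<Rightarrow> real \<Rightarrow> real \<Rightarrow> (real \<Rightarrow> real) \<Rightarrow> real \<Rightarrow> real" where
  "green_op a b \<alpha> \<beta> f t = bvp_const a b \<alpha> \<beta> f * (t - a) powr (\<alpha> - 1) - rl_integral a \<alpha> f t"

lemma bvp_const_eqI:
  assumes "a < b" "1 < \<alpha>" "\<beta> \<le> \<alpha> - 1"
  shows "c * Gamma \<alpha> / Gamma (\<alpha> - \<beta>) * (b - a) powr (\<alpha> - 1 - \<beta>) = rl_integral a (\<alpha> - \<beta>) h b
    \<longleftrightarrow> c = bvp_const a b \<alpha> \<beta> h"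
proof -
  have 1: "Gamma \<alpha> > 0" "Gamma (\<alpha> - \<beta>) > 0" using assms by (auto intro: Gamma_real_pos)
  have 2: "c * x / y * z = r \<longleftrightarrow> c = y / x * r / z" if "x > 0" "y > 0" "z > 0" for x y z r :: real
    using that by (auto simp: field_simps)
  have 3: "(b - a) powr (\<alpha> - 1 - \<beta>) > 0" using assms by simp
  show ?thesis unfolding bvp_const_def by (rule 2[OF 1 3])
qed

lemma bvp_solution_green_op:
  assumes "a < b" "1 < \<alpha>" "\<alpha> \<le> 2" "0 \<le> \<beta>" "\<beta> \<le> \<alpha> - 1" "continuous_on {a..b} q"
    and sol: "bvp_solution a b \<alpha> \<beta> q u" and t: "t \<in> {a..b}"
  shows "u t = green_op a b \<alpha> \<beta> (\<lambda>s. q s * u s) t"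
proof -
  let ?h = "\<lambda>s. q s * u s"
  have u: "continuous_on {a..b} u" "u a = 0" "has_rl_derivative a b \<beta> u b 0"
    using sol by (auto simp: bvp_solution_def)
  have h: "continuous_on {a..b} ?h" using u assms by (intro continuous_intros)
  have "has_rl_derivative a b \<alpha> u t (- ?h t)" if t: "t \<in> {a..b}" for t
  proof -
    obtain d where "has_rl_derivative a b \<alpha> u t d" "d + q t * u t = 0"
      using sol t unfolding bvp_solution_def by blast
    moreover from this have "d = - ?h t" by simp
    ultimately show ?thesis by simp
  qed
  from rl_equation_representation[OF assms(1-3) u(1) h u(2) this] obtain c where
    c: "\<And>t. t \<in> {a..b} \<Longrightarrow> u t = c * (t - a) powr (\<alpha> - 1) - rl_integral a \<alpha> ?h t" by blast
  have "c * Gamma \<alpha> / Gamma (\<alpha> - \<beta>) * (b - a) powr (\<alpha> - 1 - \<beta>) = rl_integral a (\<alpha> - \<beta>) ?h b"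
  proof (cases "\<beta> = 0")
    case True
    then have "u b = 0" using u(3) by (simp add: has_rl_derivative_def)
    then have "c * (b - a) powr (\<alpha> - 1) = rl_integral a \<alpha> ?h b"
      using c[of b] assms by simp
    moreover have "Gamma \<alpha> > 0" using assms by (simp add: Gamma_real_pos)
    then have "c * Gamma \<alpha> / Gamma \<alpha> = c" by (metis less_irrefl nonzero_mult_div_cancel_right)
    ultimately show ?thesis using True by simp
  next
    case False
    then have "\<lceil>\<beta>\<rceil> = 1" using assms by (simp add: ceiling_eq_iff)
    then have n: "nat \<lceil>\<beta>\<rceil> = Suc 0" by simp
    have "has_nth_derivative_within (Suc 0) {a..b} (rl_integral a (1 - \<beta>) u) b 0"
      using u(3) by (simp add: has_rl_derivative_def n Let_def del: has_nth_derivative_within.simps)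
    from has_nth_derivative_within_oneD[OF this] have
      "(rl_integral a (1 - \<beta>) u has_real_derivative 0) (at b within {a..b})" using assms by simp
    moreover have "(rl_integral a (1 - \<beta>) u has_real_derivative
       c * Gamma \<alpha> / Gamma (\<alpha> - \<beta>) * (b - a) powr (\<alpha> - 1 - \<beta>) - rl_integral a (\<alpha> - \<beta>) ?h b) (at b within {a..b})"
      using assms by (intro two_term_derivative h c) auto
    ultimately show ?thesis
      using vector_derivative_unique_within_closed_interval[of a b b "rl_integral a (1 - \<beta>) u" 0
        "c * Gamma \<alpha> / Gamma (\<alpha> - \<beta>) * (b - a) powr (\<alpha> - 1 - \<beta>) - rl_integral a (\<alpha> - \<beta>) ?h b"] assms
      by (auto simp: has_real_derivative_iff_has_vector_derivative)
  qed
  then have "c = bvp_const a b \<alpha> \<beta> ?h" using bvp_const_eqI assms by blast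
  then show ?thesis using c[OF t] by (simp add: green_op_def)
qed

section \<open>Bounds for the Green function\<close>

text \<open>
  The factor of the Green function that comes from the condition at \<open>b\<close>.  The case distinction makes
  it continuous at \<open>b\<close> also for \<open>e = 0\<close>, where \<open>0 powr 0 = 0\<close> would produce a jump.
\<close>
definition endpoint_weight :: "real \<Rightarrow> real \<Rightarrow> real \<Rightarrow> real \<Rightarrow> real" where
  "endpoint_weight a b e s = (if e = 0 then 1 else ((b - s) / (b - a)) powr e)"

lemma continuous_on_endpoint_weight:
  assumes "a < b" "0 \<le> e"
  shows "continuous_on {a..b} (endpoint_weight a b e)"
proof (cases "e = 0")
  case False
  then have "endpoint_weight a b e = (\<lambda>s. ((b - s) / (b - a)) powr e)"
    by (auto simp: endpoint_weight_def)
  moreover have "continuous_on {a..b} (\<lambda>s. ((b - s) / (b - a)) powr e)"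
    using assms False by (intro continuous_on_powr' continuous_on_divide continuous_intros) auto
  ultimately show ?thesis by simp
qed (simp add: endpoint_weight_def)

lemma endpoint_weight_bounds:
  assumes "a < b" "0 \<le> e" "s \<in> {a..b}"
  shows "0 \<le> endpoint_weight a b e s" "endpoint_weight a b e s \<le> 1"
  using assms powr_le1[of e "(b - s) / (b - a)"] by (auto simp: endpoint_weight_def)

lemma powr_subadditive:
  fixes x y p :: real
  assumes "0 \<le> x" "0 \<le> y" "0 < p" "p \<le> 1"
  shows "(x + y) powr p \<le> x powr p + y powr p"
proof (cases "x + y = 0")
  case False
  then have s: "x + y > 0" using assms by simp
  have le: "z / (x + y) \<le> (z / (x + y)) powr p" if "0 \<le> z" "z \<le> x + y" for z
    using powr_mono'[of p 1 "z / (x + y)"] that assms s by simp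
  have "1 = x / (x + y) + y / (x + y)" using s by (simp add: add_divide_distrib[symmetric])
  also have "\<dots> \<le> (x / (x + y)) powr p + (y / (x + y)) powr p"
    using assms by (intro add_mono le) auto
  also have "\<dots> = (x powr p + y powr p) / (x + y) powr p"
    using assms by (simp add: powr_divide add_divide_distrib)
  finally show ?thesis using s by (simp add: field_simps)
qed simp

text \<open>
  Nonnegativity of the Green function below the diagonal: \<open>(t - s) / (t - a) \<le> (b - s) / (b - a) \<le> 1\<close>,
  and \<open>e \<le> p\<close>.
\<close>
lemma green_kernel_lower:
  assumes "a \<le> s" "s \<le> t" "t \<le> b" "a < b" "0 \<le> e" "e \<le> p" "0 < p"
  shows "(t - s) powr p \<le> (t - a) powr p * endpoint_weight a b e s"
proof (cases "t = a")
  case True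
  then show ?thesis using assms by simp
next
  case False
  define r where "r = (b - s) / (b - a)"
  have r: "0 \<le> r" "r \<le> 1" using assms by (auto simp: r_def)
  have "(t - a) * (b - s) - (t - s) * (b - a) = (s - a) * (b - t)" by (simp add: algebra_simps)
  moreover have "(s - a) * (b - t) \<ge> 0" using assms by simp
  ultimately have "(t - s) * (b - a) \<le> (t - a) * (b - s)" by simp
  then have "t - s \<le> (t - a) * r" using assms by (simp add: r_def field_simps)
  then have "(t - s) powr p \<le> ((t - a) * r) powr p" using assms by (intro powr_mono2) auto
  also have "\<dots> = (t - a) powr p * r powr p" using assms r by (simp add: powr_mult)
  also have "\<dots> \<le> (t - a) powr p * endpoint_weight a b e s"
  proof (rule mult_left_mono)
    show "r powr p \<le> endpoint_weight a b e s"
      using r assms powr_mono'[of e p r] powr_le1[of p r] by (auto simp: endpoint_weight_def r_def)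
  qed simp
  finally show ?thesis .
qed

text \<open>
  For fixed \<open>s\<close> the Green function is largest on the diagonal \<open>t = s\<close>.  For \<open>t \<ge> s\<close> this follows from
  subadditivity of \<open>x powr p\<close> and from the weight being at most \<open>1\<close>.
\<close>
lemma green_kernel_upper:
  assumes "a \<le> s" "s \<le> t" "t \<le> b" "a < b" "0 \<le> e" "0 < p" "p \<le> 1"
  shows "(t - a) powr p * endpoint_weight a b e s - (t - s) powr p \<le> (s - a) powr p * endpoint_weight a b e s"
proof -
  have w: "0 \<le> endpoint_weight a b e s" "endpoint_weight a b e s \<le> 1"
    using endpoint_weight_bounds[of a b e s] assms by auto
  have "(t - a) powr p \<le> (s - a) powr p + (t - s) powr p"
    using powr_subadditive[of "s - a" "t - s" p] assms by simp
  then have "(t - a) powr p * endpoint_weight a b e s \<le> ((s - a) powr p + (t - s) powr p) * endpoint_weight a b e s"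
    using w by (intro mult_right_mono)
  also have "\<dots> \<le> (s - a) powr p * endpoint_weight a b e s + (t - s) powr p"
    using w mult_left_mono[OF w(2), of "(t - s) powr p"] by (simp add: algebra_simps)
  finally show ?thesis by simp
qed

lemma bvp_const_integral:
  assumes "a < b" "\<beta> \<le> \<alpha> - 1"
  shows "bvp_const a b \<alpha> \<beta> f = 1 / Gamma \<alpha> * integral {a..b} (\<lambda>s. endpoint_weight a b (\<alpha> - 1 - \<beta>) s * f s)"
proof -
  let ?e = "\<alpha> - 1 - \<beta>"
  have "integral {a..b} (\<lambda>s. (b - s) powr (\<alpha> - \<beta> - 1) * f s)
      = integral {a..b} (\<lambda>s. (b - a) powr ?e * (endpoint_weight a b ?e s * f s))"
  proof (rule integral_spike[of "{b}"])
    fix s assume s: "s \<in> {a..b} - {b}"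
    have e: "\<alpha> - \<beta> - 1 = ?e" by simp
    show "(b - a) powr ?e * (endpoint_weight a b ?e s * f s) = (b - s) powr (\<alpha> - \<beta> - 1) * f s"
      unfolding e using s assms by (auto simp: endpoint_weight_def powr_divide)
  qed auto
  also have "\<dots> = (b - a) powr ?e * integral {a..b} (\<lambda>s. endpoint_weight a b ?e s * f s)"
    by simp
  finally have 1: "rl_integral a (\<alpha> - \<beta>) f b
      = 1 / Gamma (\<alpha> - \<beta>) * ((b - a) powr ?e * integral {a..b} (\<lambda>s. endpoint_weight a b ?e s * f s))"
    using assms by (simp add: rl_integral_def)
  have 2: "x / y * (1 / x * (z * w)) / z = 1 / y * w" if "x > 0" "z > 0" for x y z w :: real
    using that by simp
  have "Gamma (\<alpha> - \<beta>) > 0" "(b - a) powr ?e > 0" using assms by (auto intro: Gamma_real_pos)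
  then show ?thesis unfolding bvp_const_def 1 by (rule 2)
qed

lemma green_op_cmult: "green_op a b \<alpha> \<beta> (\<lambda>s. c * f s) t = c * green_op a b \<alpha> \<beta> f t"
  by (simp add: green_op_def bvp_const_def rl_integral_cmult algebra_simps)

lemma green_op_diff:
  assumes "0 < \<alpha>" "\<beta> < \<alpha>" "continuous_on {a..b} f" "continuous_on {a..b} g" "t \<in> {a..b}"
  shows "green_op a b \<alpha> \<beta> (\<lambda>s. f s - g s) t = green_op a b \<alpha> \<beta> f t - green_op a b \<alpha> \<beta> g t"
proof -
  have "rl_integral a (\<alpha> - \<beta>) (\<lambda>s. f s - g s) b = rl_integral a (\<alpha> - \<beta>) f b - rl_integral a (\<alpha> - \<beta>) g b"
    using assms by (intro rl_integral_diff) auto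
  moreover have "rl_integral a \<alpha> (\<lambda>s. f s - g s) t = rl_integral a \<alpha> f t - rl_integral a \<alpha> g t"
    using assms by (intro rl_integral_diff) (auto elim: continuous_on_subset)
  ultimately show ?thesis
    by (simp add: green_op_def bvp_const_def diff_divide_distrib right_diff_distrib left_diff_distrib)
qed

lemma continuous_on_green_op:
  assumes "1 < \<alpha>" "continuous_on {a..b} f"
  shows "continuous_on {a..b} (green_op a b \<alpha> \<beta> f)"
  unfolding green_op_def using assms
  by (intro continuous_on_diff continuous_on_mult_left continuous_on_powr_shift continuous_on_rl_integral) auto

lemma green_op_nonneg:
  assumes "a < b" "1 < \<alpha>" "0 \<le> \<beta>" "\<beta> \<le> \<alpha> - 1" "continuous_on {a..b} f"
    and "\<And>s. s \<in> {a..b} \<Longrightarrow> 0 \<le> f s" "t \<in> {a..b}"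
  shows "0 \<le> green_op a b \<alpha> \<beta> f t"
proof -
  let ?w = "endpoint_weight a b (\<alpha> - 1 - \<beta>)"
  have w: "continuous_on {a..b} ?w" using assms by (intro continuous_on_endpoint_weight) auto
  have wf: "continuous_on {a..b} (\<lambda>s. ?w s * f s)" using w assms by (intro continuous_intros)
  have st: "{a..t} \<subseteq> {a..b}" using assms by auto
  have "integral {a..t} (\<lambda>s. (t - s) powr (\<alpha> - 1) * f s) \<le> integral {a..t} (\<lambda>s. (t - a) powr (\<alpha> - 1) * (?w s * f s))"
  proof (rule Henstock_Kurzweil_Integration.integral_le)
    show "(\<lambda>s. (t - s) powr (\<alpha> - 1) * f s) integrable_on {a..t}"
      using assms by (intro rl_kernel_integrable continuous_on_subset[OF assms(5) st]) auto
    show "(\<lambda>s. (t - a) powr (\<alpha> - 1) * (?w s * f s)) integrable_on {a..t}"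
      by (intro integrable_continuous_real continuous_on_mult_left continuous_on_subset[OF wf st])
    fix s assume s: "s \<in> {a..t}"
    have "(t - s) powr (\<alpha> - 1) * f s \<le> ((t - a) powr (\<alpha> - 1) * ?w s) * f s"
      using s assms by (intro mult_right_mono green_kernel_lower) auto
    then show "(t - s) powr (\<alpha> - 1) * f s \<le> (t - a) powr (\<alpha> - 1) * (?w s * f s)" by (simp add: mult.assoc)
  qed
  also have "\<dots> \<le> integral {a..b} (\<lambda>s. (t - a) powr (\<alpha> - 1) * (?w s * f s))"
    using assms endpoint_weight_bounds(1)[of a b "\<alpha> - 1 - \<beta>"]
    by (intro integral_subset_le st integrable_continuous_real continuous_on_mult_left continuous_on_subset[OF wf] mult_nonneg_nonneg) auto
  finally have "integral {a..t} (\<lambda>s. (t - s) powr (\<alpha> - 1) * f s)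
     \<le> (t - a) powr (\<alpha> - 1) * integral {a..b} (\<lambda>s. ?w s * f s)" by simp
  then have "1 / Gamma \<alpha> * integral {a..t} (\<lambda>s. (t - s) powr (\<alpha> - 1) * f s)
     \<le> 1 / Gamma \<alpha> * ((t - a) powr (\<alpha> - 1) * integral {a..b} (\<lambda>s. ?w s * f s))"
    using assms by (intro mult_left_mono) (auto simp: Gamma_real_pos less_imp_le)
  then show ?thesis
    using assms by (simp add: green_op_def bvp_const_integral rl_integral_pos mult_ac)
qed

lemma green_op_mono:
  assumes "a < b" "1 < \<alpha>" "0 \<le> \<beta>" "\<beta> \<le> \<alpha> - 1" "continuous_on {a..b} f" "continuous_on {a..b} g"
    and "\<And>s. s \<in> {a..b} \<Longrightarrow> f s \<le> g s" "t \<in> {a..b}"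
  shows "green_op a b \<alpha> \<beta> f t \<le> green_op a b \<alpha> \<beta> g t"
proof -
  have "0 \<le> green_op a b \<alpha> \<beta> (\<lambda>s. g s - f s) t"
    using assms by (intro green_op_nonneg continuous_on_diff) auto
  then show ?thesis using green_op_diff[of \<alpha> \<beta> a b g f t] assms by simp
qed

text \<open>
  The kernel on the right is the diagonal of the Green function.  The range of integration is split at
  \<open>t\<close>: on the left the previous comparison applies, on the right the kernel increases in \<open>t\<close>.
\<close>
lemma green_op_upper:
  assumes "a < b" "1 < \<alpha>" "\<alpha> \<le> 2" "0 \<le> \<beta>" "\<beta> \<le> \<alpha> - 1" "continuous_on {a..b} f"
    and "\<And>s. s \<in> {a..b} \<Longrightarrow> 0 \<le> f s" "t \<in> {a..b}"
  shows "green_op a b \<alpha> \<beta> f t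
    \<le> 1 / Gamma \<alpha> * integral {a..b} (\<lambda>s. (s - a) powr (\<alpha> - 1) * endpoint_weight a b (\<alpha> - 1 - \<beta>) s * f s)"
proof -
  let ?w = "endpoint_weight a b (\<alpha> - 1 - \<beta>)" and ?p = "\<alpha> - 1"
  let ?K = "\<lambda>s. (t - a) powr ?p * (?w s * f s)"
  let ?g = "\<lambda>s. (s - a) powr ?p * ?w s * f s"
  have w: "continuous_on {a..b} ?w" using assms by (intro continuous_on_endpoint_weight) auto
  have wf: "continuous_on {a..b} ?K" using w assms by (intro continuous_intros)
  have gf: "continuous_on {a..b} ?g" using w assms by (intro continuous_intros continuous_on_powr_shift) auto
  have st: "{a..t} \<subseteq> {a..b}" "{t..b} \<subseteq> {a..b}" using assms by auto
  have int: "F integrable_on {a..b}" "F integrable_on {a..t}" "F integrable_on {t..b}" if "continuous_on {a..b} F" for F :: "real \<Rightarrow> real"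
    using that st by (auto intro!: integrable_continuous_real elim: continuous_on_subset)
  have k: "(\<lambda>s. (t - s) powr ?p * f s) integrable_on {a..t}"
    using assms by (intro rl_kernel_integrable continuous_on_subset[OF assms(6) st(1)]) auto
  have "integral {a..b} ?K - integral {a..t} (\<lambda>s. (t - s) powr ?p * f s)
     = integral {a..t} (\<lambda>s. ?K s - (t - s) powr ?p * f s) + integral {t..b} ?K"
    using Henstock_Kurzweil_Integration.integral_combine[of a t b ?K] int[OF wf] k assms
    by (simp add: Henstock_Kurzweil_Integration.integral_diff)
  also have "\<dots> \<le> integral {a..t} ?g + integral {t..b} ?g"
  proof (intro add_mono Henstock_Kurzweil_Integration.integral_le)
    fix s assume s: "s \<in> {a..t}"
    have "((t - a) powr ?p * ?w s - (t - s) powr ?p) * f s \<le> ?g s"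
      using s assms by (intro mult_right_mono green_kernel_upper) auto
    then show "?K s - (t - s) powr ?p * f s \<le> ?g s" by (simp add: algebra_simps)
  next
    fix s assume s: "s \<in> {t..b}"
    have "((t - a) powr ?p * ?w s) * f s \<le> ?g s"
      using s assms endpoint_weight_bounds(1)[of a b "\<alpha> - 1 - \<beta>" s]
      by (intro mult_right_mono powr_mono2) auto
    then show "?K s \<le> ?g s" by (simp add: mult.assoc)
  qed (use int[OF wf] int[OF gf] k in \<open>auto intro: integrable_diff\<close>)
  also have "\<dots> = integral {a..b} ?g"
    using Henstock_Kurzweil_Integration.integral_combine[of a t b ?g] int[OF gf] assms by simp
  finally have *: "integral {a..b} ?K - integral {a..t} (\<lambda>s. (t - s) powr ?p * f s) \<le> integral {a..b} ?g" .
  have "green_op a b \<alpha> \<beta> f t = 1 / Gamma \<alpha> * (integral {a..b} ?K - integral {a..t} (\<lambda>s. (t - s) powr ?p * f s))"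
  proof -
    have "integral {a..b} ?K = (t - a) powr ?p * integral {a..b} (\<lambda>s. ?w s * f s)" by simp
    then show ?thesis
      using assms by (simp only: green_op_def bvp_const_integral) (simp add: rl_integral_pos algebra_simps)
  qed
  also have "\<dots> \<le> 1 / Gamma \<alpha> * integral {a..b} ?g"
    using * assms by (intro mult_left_mono) (auto simp: Gamma_real_pos less_imp_le)
  finally show ?thesis .
qed

section \<open>Differences of singular convolutions\<close>

text \<open>
  The kernel decreases, so moving its singularity from \<open>c - h\<close> to \<open>c\<close> lowers the integrand on the left of \<open>c - h\<close>;
  the remaining piece has length \<open>h\<close>, and there the kernel has integral \<open>h powr \<nu> / \<nu>\<close>.
\<close>
lemma kernel_first_difference:
  fixes \<nu> h c M :: real
  assumes "0 < \<nu>" "\<nu> \<le> 1" "0 < h" "a \<le> c - h" "continuous_on {a..c} y"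
    and "\<And>s. s \<in> {a..c} \<Longrightarrow> 0 \<le> y s" "\<And>s. s \<in> {c - h..c} \<Longrightarrow> y s \<le> M"
  shows "integral {a..c} (\<lambda>s. (c - s) powr (\<nu> - 1) * y s)
     \<le> integral {a..c - h} (\<lambda>s. (c - h - s) powr (\<nu> - 1) * y s) + M * h powr \<nu> / \<nu>"
proof -
  have k: "(\<lambda>s. (c - s) powr (\<nu> - 1) * y s) integrable_on {a..c}"
    using assms by (intro rl_kernel_integrable) auto
  have k1: "(\<lambda>s. (c - s) powr (\<nu> - 1) * y s) integrable_on {a..c - h}"
    "(\<lambda>s. (c - s) powr (\<nu> - 1) * y s) integrable_on {c - h..c}"
    using k assms by (auto intro: integrable_on_subinterval)
  have k2: "(\<lambda>s. (c - h - s) powr (\<nu> - 1) * y s) integrable_on {a..c - h}"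
    using assms by (intro rl_kernel_integrable) (auto elim: continuous_on_subset)
  have "integral {c - h..c} (\<lambda>s. (c - s) powr (\<nu> - 1) * y s) \<le> integral {c - h..c} (\<lambda>s. (c - s) powr (\<nu> - 1) * M)"
    using rl_kernel_integrable[of \<nu> "c - h" c "\<lambda>_. M"] k1 assms
    by (intro Henstock_Kurzweil_Integration.integral_le mult_left_mono) auto
  also have "\<dots> = M * h powr \<nu> / \<nu>"
    using integral_unique[OF rl_kernel_has_integral[of \<nu> "c - h" c]] assms by simp
  finally have 1: "integral {c - h..c} (\<lambda>s. (c - s) powr (\<nu> - 1) * y s) \<le> M * h powr \<nu> / \<nu>" .
  have "integral {a..c - h} (\<lambda>s. (c - s) powr (\<nu> - 1) * y s)
     = integral {a..c - h} (\<lambda>s. if s = c - h then 0 else (c - s) powr (\<nu> - 1) * y s)"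
    by (rule integral_spike[of "{c - h}"]) auto
  also have "\<dots> \<le> integral {a..c - h} (\<lambda>s. (c - h - s) powr (\<nu> - 1) * y s)"
  proof (rule Henstock_Kurzweil_Integration.integral_le[OF _ k2])
    show "(\<lambda>s. if s = c - h then 0 else (c - s) powr (\<nu> - 1) * y s) integrable_on {a..c - h}"
      by (rule integrable_spike[OF k1(1), of "{c - h}"]) auto
    fix s assume s: "s \<in> {a..c - h}"
    then show "(if s = c - h then 0 else (c - s) powr (\<nu> - 1) * y s) \<le> (c - h - s) powr (\<nu> - 1) * y s"
      using assms by (auto intro!: mult_right_mono powr_mono2')
  qed
  finally show ?thesis
    using 1 Henstock_Kurzweil_Integration.integral_combine[of a "c - h" c "\<lambda>s. (c - s) powr (\<nu> - 1) * y s"] k assms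
    by simp
qed

lemma powr_midpoint_convex:
  fixes x h q :: real
  assumes "0 < h" "h < x" "q \<le> 0"
  shows "2 * x powr q \<le> (x + h) powr q + (x - h) powr q"
proof -
  define A B where "A = (x + h) powr (q / 2)" and "B = (x - h) powr (q / 2)"
  have sq: "z powr q = (z powr (q / 2)) ^ 2" if "z > 0" for z :: real
    using that by (simp add: power2_eq_square powr_add[symmetric])
  \<comment> \<open>The geometric mean of the outer values already dominates the middle value.\<close>
  have "(x + h) * (x - h) \<le> x * x" by (simp add: algebra_simps)
  then have "(x * x) powr (q / 2) \<le> ((x + h) * (x - h)) powr (q / 2)"
    using assms by (intro powr_mono2') auto
  then have "x powr q \<le> A * B" using assms sq[of x]
    by (simp add: A_def B_def powr_mult power2_eq_square)
  moreover have "2 * (A * B) \<le> A ^ 2 + B ^ 2" using sum_squares_bound[of A B] by simp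
  ultimately show ?thesis using assms sq[of "x + h"] sq[of "x - h"] by (simp add: A_def B_def)
qed

text \<open>
  Convexity of the kernel makes its second difference nonnegative at distances larger than \<open>h\<close> from the
  singularity.  Closer to it only the middle term has the wrong sign, and it is paid for by the bound
  \<open>M\<close> on \<open>y\<close>.
\<close>
lemma kernel_second_difference:
  fixes \<nu> h c M :: real
  assumes "0 < \<nu>" "\<nu> \<le> 1" "0 < h" "a \<le> c - h" "continuous_on {a..c + h} y"
    and "\<And>s. s \<in> {a..c + h} \<Longrightarrow> 0 \<le> y s" "\<And>s. s \<in> {c - h..c} \<Longrightarrow> y s \<le> M"
  shows "2 * integral {a..c} (\<lambda>s. (c - s) powr (\<nu> - 1) * y s)
     \<le> integral {a..c + h} (\<lambda>s. (c + h - s) powr (\<nu> - 1) * y s)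
       + integral {a..c - h} (\<lambda>s. (c - h - s) powr (\<nu> - 1) * y s) + 2 * (M * h powr \<nu> / \<nu>)"
proof -
  have k: "(\<lambda>s. (c - s) powr (\<nu> - 1) * y s) integrable_on {a..c}"
    using assms by (intro rl_kernel_integrable) (auto elim: continuous_on_subset)
  have k1: "(\<lambda>s. (c - s) powr (\<nu> - 1) * y s) integrable_on {a..c - h}"
    "(\<lambda>s. (c - s) powr (\<nu> - 1) * y s) integrable_on {c - h..c}"
    using k assms by (auto intro: integrable_on_subinterval)
  have k2: "(\<lambda>s. (c - h - s) powr (\<nu> - 1) * y s) integrable_on {a..c - h}"
    using assms by (intro rl_kernel_integrable) (auto elim: continuous_on_subset)
  have k3: "(\<lambda>s. (c + h - s) powr (\<nu> - 1) * y s) integrable_on {a..c + h}"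
    using assms by (intro rl_kernel_integrable) auto
  then have k4: "(\<lambda>s. (c + h - s) powr (\<nu> - 1) * y s) integrable_on {a..c - h}"
    using assms by (auto intro: integrable_on_subinterval)
  have "integral {c - h..c} (\<lambda>s. (c - s) powr (\<nu> - 1) * y s) \<le> integral {c - h..c} (\<lambda>s. (c - s) powr (\<nu> - 1) * M)"
    using rl_kernel_integrable[of \<nu> "c - h" c "\<lambda>_. M"] k1 assms
    by (intro Henstock_Kurzweil_Integration.integral_le mult_left_mono) auto
  also have "\<dots> = M * h powr \<nu> / \<nu>"
    using integral_unique[OF rl_kernel_has_integral[of \<nu> "c - h" c]] assms by simp
  finally have 1: "integral {c - h..c} (\<lambda>s. (c - s) powr (\<nu> - 1) * y s) \<le> M * h powr \<nu> / \<nu>" .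
  let ?D = "\<lambda>s. (c + h - s) powr (\<nu> - 1) * y s + (c - h - s) powr (\<nu> - 1) * y s"
  have "integral {a..c - h} (\<lambda>s. 2 * ((c - s) powr (\<nu> - 1) * y s))
     = integral {a..c - h} (\<lambda>s. if s = c - h then 0 else 2 * ((c - s) powr (\<nu> - 1) * y s))"
    by (rule integral_spike[of "{c - h}"]) auto
  also have "\<dots> \<le> integral {a..c - h} ?D"
  proof (rule Henstock_Kurzweil_Integration.integral_le)
    show "(\<lambda>s. if s = c - h then 0 else 2 * ((c - s) powr (\<nu> - 1) * y s)) integrable_on {a..c - h}"
      by (rule integrable_spike[OF integrable_on_mult_right[OF k1(1), of 2], of "{c - h}"]) auto
    show "?D integrable_on {a..c - h}" using k2 k4 by (rule integrable_add[rotated])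
    fix s assume s: "s \<in> {a..c - h}"
    show "(if s = c - h then 0 else 2 * ((c - s) powr (\<nu> - 1) * y s)) \<le> ?D s"
    proof (cases "s = c - h")
      case False
      then have "2 * (c - s) powr (\<nu> - 1) \<le> (c - s + h) powr (\<nu> - 1) + (c - s - h) powr (\<nu> - 1)"
        using s assms by (intro powr_midpoint_convex) auto
      moreover have "c - s + h = c + h - s" "c - s - h = c - h - s" by simp_all
      ultimately have "2 * (c - s) powr (\<nu> - 1) * y s \<le> ((c + h - s) powr (\<nu> - 1) + (c - h - s) powr (\<nu> - 1)) * y s"
        using s assms by (intro mult_right_mono) auto
      then show ?thesis using False by (simp add: algebra_simps)
    qed (use s assms in auto)
  qed
  also have "\<dots> = integral {a..c - h} (\<lambda>s. (c + h - s) powr (\<nu> - 1) * y s)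
      + integral {a..c - h} (\<lambda>s. (c - h - s) powr (\<nu> - 1) * y s)"
    using k4 k2 by (rule Henstock_Kurzweil_Integration.integral_add)
  also have "integral {a..c - h} (\<lambda>s. (c + h - s) powr (\<nu> - 1) * y s)
     \<le> integral {a..c + h} (\<lambda>s. (c + h - s) powr (\<nu> - 1) * y s)"
    using assms k3 k4 by (intro integral_subset_le) auto
  finally have "2 * integral {a..c - h} (\<lambda>s. (c - s) powr (\<nu> - 1) * y s)
     \<le> integral {a..c + h} (\<lambda>s. (c + h - s) powr (\<nu> - 1) * y s)
      + integral {a..c - h} (\<lambda>s. (c - h - s) powr (\<nu> - 1) * y s)" by simp
  then show ?thesis
    using 1 Henstock_Kurzweil_Integration.integral_combine[of a "c - h" c "\<lambda>s. (c - s) powr (\<nu> - 1) * y s"] k assms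
    by simp
qed

lemma powr_le_linear:
  fixes x \<nu> :: real
  assumes "0 \<le> x" "0 < \<nu>" "\<nu> \<le> 1"
  shows "x powr \<nu> \<le> \<nu> * x + (1 - \<nu>)"
proof (cases "x = 0")
  case False
  then show ?thesis using Youngs_inequality_0[of \<nu> "1 - \<nu>" x 1] assms by simp
qed (use assms in simp)

lemma powr_midpoint_concave:
  fixes z h \<nu> :: real
  assumes "0 < z" "0 \<le> h" "h \<le> z" "0 < \<nu>" "\<nu> \<le> 1"
  shows "(z + h) powr \<nu> + (z - h) powr \<nu> \<le> 2 * z powr \<nu>"
proof -
  have e: "z + h = z * (1 + h / z)" "z - h = z * (1 - h / z)" using assms by (auto simp: field_simps)
  have "(1 + h / z) powr \<nu> \<le> \<nu> * (1 + h / z) + (1 - \<nu>)" "(1 - h / z) powr \<nu> \<le> \<nu> * (1 - h / z) + (1 - \<nu>)"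
    using assms by (intro powr_le_linear; simp)+
  then have "(1 + h / z) powr \<nu> + (1 - h / z) powr \<nu> \<le> 2" by (simp add: algebra_simps)
  then have "z powr \<nu> * ((1 + h / z) powr \<nu> + (1 - h / z) powr \<nu>) \<le> z powr \<nu> * 2"
    by (intro mult_left_mono) auto
  moreover have "(z * (1 + h / z)) powr \<nu> = z powr \<nu> * (1 + h / z) powr \<nu>"
    "(z * (1 - h / z)) powr \<nu> = z powr \<nu> * (1 - h / z) powr \<nu>"
    using assms by (intro powr_mult; simp)+
  ultimately show ?thesis unfolding e by (simp only: distrib_left mult.commute)
qed

lemma powr_tangent_upper:
  fixes z h \<nu> :: real
  assumes "0 < z" "0 \<le> h" "h \<le> z" "0 < \<nu>" "\<nu> \<le> 1"
  shows "(z - h) powr \<nu> \<le> z powr \<nu> - \<nu> * z powr (\<nu> - 1) * h"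
proof -
  have e: "z - h = z * (1 - h / z)" using assms by (auto simp: field_simps)
  have "(1 - h / z) powr \<nu> \<le> \<nu> * (1 - h / z) + (1 - \<nu>)"
    using assms by (intro powr_le_linear) auto
  then have "z powr \<nu> * (1 - h / z) powr \<nu> \<le> z powr \<nu> * (1 - \<nu> * (h / z))"
    by (intro mult_left_mono) (auto simp: algebra_simps)
  also have "\<dots> = z powr \<nu> - \<nu> * z powr (\<nu> - 1) * h"
    using assms by (simp add: powr_diff right_diff_distrib)
  finally show ?thesis unfolding e using assms by (simp add: powr_mult)
qed

text \<open>
  Subtracting \<open>\<eta> (t - c)\<^sup>2 / 2\<close> leaves a convex function.
\<close>
lemma second_difference_lower:
  fixes F F1 F2 :: "real \<Rightarrow> real"
  assumes "0 < h"
    and "\<And>t. t \<in> {c - h..c + h} \<Longrightarrow> (F has_real_derivative F1 t) (at t)"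
    and "\<And>t. t \<in> {c - h..c + h} \<Longrightarrow> (F1 has_real_derivative F2 t) (at t)"
    and "\<And>t. t \<in> {c - h..c + h} \<Longrightarrow> \<eta> \<le> F2 t"
  shows "\<eta> * h ^ 2 \<le> F (c + h) + F (c - h) - 2 * F c"
proof -
  define G where "G = (\<lambda>t. F t - \<eta> * (t - c) ^ 2 / 2)"
  have "convex_on {c - h..c + h} G"
  proof (rule f''_ge0_imp_convex)
    fix t assume t: "t \<in> {c - h..c + h}"
    show "(G has_real_derivative F1 t - \<eta> * (t - c)) (at t)"
      unfolding G_def by (auto intro!: derivative_eq_intros assms(2) t)
    show "((\<lambda>t. F1 t - \<eta> * (t - c)) has_real_derivative F2 t - \<eta>) (at t)"
      by (auto intro!: derivative_eq_intros assms(3) t)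
    show "F2 t - \<eta> \<ge> 0" using assms(4) t by simp
  qed auto
  from convex_onD[OF this, of "1/2" "c - h" "c + h"] have "2 * G c \<le> G (c - h) + G (c + h)"
    using assms(1) by (simp add: field_simps)
  then show ?thesis unfolding G_def by (simp add: algebra_simps)
qed

section \<open>The maximum principle\<close>

text \<open>
  On polynomials the operator is explicit, a finite sum of real powers of \<open>t - a\<close>.
\<close>
lemma green_op_polynomial_smooth:
  assumes "0 < \<alpha>" "p = (\<lambda>s. \<Sum>i\<le>n. c i * (s - a) ^ i)"
  obtains P P1 P2 where "\<And>t. t \<in> {a..b} \<Longrightarrow> green_op a b \<alpha> \<beta> p t = P t"
    "\<And>t. a < t \<Longrightarrow> (P has_real_derivative P1 t) (at t)"
    "\<And>t. a < t \<Longrightarrow> (P1 has_real_derivative P2 t) (at t)"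
    "continuous_on {a<..} P2"
proof -
  define d where "d i = c i * (Gamma (real i + 1) / Gamma (real i + 1 + \<alpha>))" for i
  define C where "C = bvp_const a b \<alpha> \<beta> p"
  define r where "r i = real i + \<alpha>" for i
  define q where "q = \<alpha> - 1"
  define P where "P = (\<lambda>t. C * (t - a) powr q - (\<Sum>i\<le>n. d i * (t - a) powr r i))"
  define P1 where "P1 = (\<lambda>t. C * (q * (t - a) powr (q - 1)) - (\<Sum>i\<le>n. d i * (r i * (t - a) powr (r i - 1))))"
  define P2 where "P2 = (\<lambda>t. C * (q * ((q - 1) * (t - a) powr (q - 2)))
     - (\<Sum>i\<le>n. d i * (r i * ((r i - 1) * (t - a) powr (r i - 2)))))"
  have pw: "((\<lambda>t. (t - a) powr z) has_real_derivative z * (t - a) powr (z - 1)) (at t)" if "a < t" for z t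
    using that by (auto intro!: derivative_eq_intros)
  have pw1: "((\<lambda>t. (t - a) powr (z - 1)) has_real_derivative (z - 1) * (t - a) powr (z - 2)) (at t)" if "a < t" for z t
    using pw[OF that, of "z - 1"] by simp
  show thesis
  proof (rule that[of P P1 P2])
    fix t assume "t \<in> {a..b}"
    then show "green_op a b \<alpha> \<beta> p t = P t"
      using assms(1) unfolding green_op_def P_def C_def[symmetric] q_def[symmetric]
      by (simp add: assms(2) rl_integral_polynomial d_def r_def)
  next
    fix t assume t: "a < t"
    show "(P has_real_derivative P1 t) (at t)" unfolding P_def P1_def
      by (intro DERIV_diff DERIV_cmult DERIV_sum pw t)
    show "(P1 has_real_derivative P2 t) (at t)" unfolding P2_def P1_def
      by (intro DERIV_diff DERIV_cmult DERIV_sum pw1 t)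
  next
    show "continuous_on {a<..} P2" unfolding P2_def
      by (intro continuous_intros) auto
  qed
qed

lemma interior_max_quadratic:
  fixes P P1 P2 :: "real \<Rightarrow> real"
  assumes "l < c" "c < r"
    and "\<And>t. t \<in> {l..<r} \<Longrightarrow> (P has_real_derivative P1 t) (at t)"
    and "\<And>t. t \<in> {l..<r} \<Longrightarrow> (P1 has_real_derivative P2 t) (at t)"
    and "continuous_on {l..c} P2" and "\<And>t. t \<in> {l..<r} \<Longrightarrow> P t \<le> P c"
  obtains K where "0 \<le> K" "\<And>s. s \<in> {l..c} \<Longrightarrow> P c - P s \<le> K * (c - s) ^ 2"
proof -
  have "P1 c = 0"
  proof (rule DERIV_local_max[where f = P and d = "min (c - l) (r - c)"])
    show "(P has_real_derivative P1 c) (at c)" using assms by auto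
    show "0 < min (c - l) (r - c)" using assms by simp
    show "\<forall>y. \<bar>c - y\<bar> < min (c - l) (r - c) \<longrightarrow> P y \<le> P c" using assms(6) by (auto simp: abs_less_iff)
  qed
  have "bounded (P2 ` {l..c})" using assms(5) compact_imp_bounded compact_continuous_image by blast
  then obtain K where K: "\<And>t. t \<in> {l..c} \<Longrightarrow> \<bar>P2 t\<bar> \<le> K" "K > 0"
    unfolding bounded_pos by (metis imageI real_norm_def)
  have "P c - P s \<le> K * (c - s) ^ 2" if s: "s \<in> {l..c}" for s
  proof (cases "s = c")
    case False
    then have "s < c" using s by simp
    have "\<exists>x. x > s \<and> x < c \<and> P c - P s = (c - s) * P1 x"
      using \<open>s < c\<close> s assms(2) by (intro MVT2 assms(3)) auto
    then obtain x where x: "s < x" "x < c" "P c - P s = (c - s) * P1 x" by blast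
    have "\<exists>y. y > x \<and> y < c \<and> P1 c - P1 x = (c - x) * P2 y"
      using x s assms(2) by (intro MVT2 assms(4)) auto
    then obtain y where y: "x < y" "y < c" "P1 c - P1 x = (c - x) * P2 y" by blast
    have "P1 x = (c - x) * (- P2 y)" using y \<open>P1 c = 0\<close> by simp
    also have "\<dots> \<le> (c - x) * K"
      using K(1)[of y] x y s by (intro mult_left_mono) auto
    also have "\<dots> \<le> (c - s) * K" using x K(2) by (intro mult_right_mono) auto
    finally have "(c - s) * P1 x \<le> (c - s) * ((c - s) * K)" using \<open>s < c\<close> by (intro mult_left_mono) auto
    then show ?thesis using x by (simp add: power2_eq_square mult_ac)
  qed simp
  with K(2) show thesis by (intro that[of K]) auto
qed

lemma green_op_double_integral:
  assumes "1 < \<alpha>" "\<alpha> \<le> 2" "continuous_on {a..b} f" "t \<in> {a..b}"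
  shows "rl_integral a (2 - \<alpha>) (green_op a b \<alpha> \<beta> f) t = bvp_const a b \<alpha> \<beta> f * Gamma \<alpha> * (t - a) - rl_integral a 2 f t"
proof -
  have "Gamma 2 = (1::real)" using Gamma_fact[of 1, where ?'a = real] by simp
  then show ?thesis
    using rl_integral_two_term[of \<alpha> "2 - \<alpha>" a b f t "bvp_const a b \<alpha> \<beta> f"] assms
    by (simp add: green_op_def[abs_def])
qed

text \<open>
  Applied with \<open>m\<close> the maximum of \<open>W\<close>: the function under the integral is then nonnegative and small near
  the place of the maximum, while the other term is explicit.
\<close>
lemma rl_integral_complement:
  assumes "0 < \<nu>" "a \<le> t" "continuous_on {a..t} W"
  shows "Gamma \<nu> * rl_integral a \<nu> W t = m * (t - a) powr \<nu> / \<nu> - integral {a..t} (\<lambda>s. (t - s) powr (\<nu> - 1) * (m - W s))"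
proof -
  have "integral {a..t} (\<lambda>s. (t - s) powr (\<nu> - 1) * (m - W s))
     = integral {a..t} (\<lambda>s. (t - s) powr (\<nu> - 1) * m - (t - s) powr (\<nu> - 1) * W s)"
    by (simp add: algebra_simps)
  also have "\<dots> = integral {a..t} (\<lambda>s. (t - s) powr (\<nu> - 1) * m) - integral {a..t} (\<lambda>s. (t - s) powr (\<nu> - 1) * W s)"
    using assms by (intro Henstock_Kurzweil_Integration.integral_diff rl_kernel_integrable) auto
  also have "integral {a..t} (\<lambda>s. (t - s) powr (\<nu> - 1) * m) = m * (t - a) powr \<nu> / \<nu>"
    using integral_unique[OF rl_kernel_has_integral[of \<nu> a t]] assms by simp
  moreover have "Gamma \<nu> > 0" using assms by (simp add: Gamma_real_pos)
  then have "Gamma \<nu> * (1 / Gamma \<nu> * X) = X" for X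
    by (metis less_irrefl mult.assoc mult.left_neutral nonzero_divide_eq_eq times_divide_eq_left mult.commute)
  ultimately show ?thesis using assms by (simp add: rl_integral_pos)
qed

text \<open>
  With \<open>F = I\<^sup>2\<^sup>-\<^sup>\<alpha> W\<close> one has \<open>F'' = - p\<close>, which is positive near \<open>c\<close>, so the second differences of \<open>F\<close> at
  \<open>c\<close> are at least \<open>\<eta> h\<^sup>2\<close>.  For \<open>\<alpha> = 2\<close> this contradicts the maximum at once, as \<open>F = W\<close>.  For
  \<open>\<alpha> < 2\<close> they are at most a multiple of \<open>h\<^sup>2 h powr (2 - \<alpha>)\<close>.
\<close>
lemma green_op_no_interior_max:
  assumes "a < b" "1 < \<alpha>" "\<alpha> \<le> 2" and p: "p = (\<lambda>s. \<Sum>i\<le>n. k i * (s - a) ^ i)"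
    and c: "c \<in> {a<..<b}" and max: "\<And>t. t \<in> {a..b} \<Longrightarrow> green_op a b \<alpha> \<beta> p t \<le> green_op a b \<alpha> \<beta> p c"
    and pos: "0 < green_op a b \<alpha> \<beta> p c" and neg: "p c < 0"
  shows False
proof -
  define W where "W = green_op a b \<alpha> \<beta> p"
  define m where "m = W c"
  define F where "F = rl_integral a (2 - \<alpha>) W"
  define C where "C = bvp_const a b \<alpha> \<beta> p * Gamma \<alpha>"
  define \<eta> where "\<eta> = - p c / 2"
  have \<eta>: "\<eta> > 0" using neg by (simp add: \<eta>_def)
  have pc: "continuous_on {a..b} p" unfolding p by (intro continuous_intros)
  have Wc: "continuous_on {a..b} W" unfolding W_def using assms pc by (intro continuous_on_green_op)
  have at: "at t within {a..b} = at t" if "t \<in> {a<..<b}" for t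
    using that by (simp add: at_within_Icc_at)
  have F1: "(F has_real_derivative C - rl_integral a 1 p t) (at t)" if t: "t \<in> {a<..<b}" for t
  proof -
    have "((\<lambda>t. C * (t - a) - rl_integral a 2 p t) has_real_derivative C - rl_integral a 1 p t) (at t within {a..b})"
      using rl_integral_Suc_deriv[of 1 a b p t] pc t by (auto intro!: derivative_eq_intros)
    then have "(F has_real_derivative C - rl_integral a 1 p t) (at t within {a..b})"
      by (rule has_field_derivative_transform_within[of _ _ _ _ 1])
        (use green_op_double_integral[OF assms(2,3) pc] t in \<open>auto simp: F_def W_def C_def\<close>)
    then show ?thesis using at[OF t] by simp
  qed
  have F2: "((\<lambda>t. C - rl_integral a 1 p t) has_real_derivative - p t) (at t)" if t: "t \<in> {a<..<b}" for t
    using rl_integral_Suc_deriv[of 0 a b p t] pc t at[OF t] by (auto intro!: derivative_eq_intros)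
  have "isCont p c" unfolding p by (intro continuous_intros)
  then have "\<forall>\<^sub>F t in at c. p t < - \<eta>"
    using neg unfolding isCont_def by (intro order_tendstoD(2)) (auto simp: \<eta>_def)
  then obtain \<delta> where \<delta>: "\<delta> > 0" "\<And>t. dist t c < \<delta> \<Longrightarrow> p t < - \<eta>"
    using neg unfolding eventually_at by (auto simp: \<eta>_def) (smt (verit, best) dist_self)
  have SD: "\<eta> * h ^ 2 \<le> F (c + h) + F (c - h) - 2 * F c" if h: "0 < h" "h < \<delta>" "a < c - h" "c + h < b" for h
  proof (rule second_difference_lower[OF h(1)])
    fix t assume t: "t \<in> {c - h..c + h}"
    then have "t \<in> {a<..<b}" using h by auto
    then show "(F has_real_derivative C - rl_integral a 1 p t) (at t)"
      "((\<lambda>t. C - rl_integral a 1 p t) has_real_derivative - p t) (at t)" by (rule F1, rule F2)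
    show "\<eta> \<le> - p t" using \<delta>(2)[of t] t h by (force simp: dist_real_def)
  qed
  define \<rho> where "\<rho> = min \<delta> (min (c - a) (b - c)) / 2"
  have \<rho>: "0 < \<rho>" "\<rho> < \<delta>" "a < c - \<rho>" "c + \<rho> < b"
    using \<delta>(1) c by (auto simp: \<rho>_def min_def field_simps)
  show False
  proof (cases "\<alpha> = 2")
    case True
    have "F (c + \<rho>) \<le> m" "F (c - \<rho>) \<le> m" "F c = m"
      using max \<rho> c True by (auto simp: F_def m_def W_def)
    moreover have "0 < \<eta> * \<rho> ^ 2" using \<eta> \<rho>(1) by simp
    ultimately show False using SD[OF \<rho>] by linarith
  next
    case False
    define \<nu> where "\<nu> = 2 - \<alpha>"
    have \<nu>: "0 < \<nu>" "\<nu> < 1" using False assms by (auto simp: \<nu>_def)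
    obtain P P1 P2 where P: "\<And>t. t \<in> {a..b} \<Longrightarrow> W t = P t"
      "\<And>t. a < t \<Longrightarrow> (P has_real_derivative P1 t) (at t)"
      "\<And>t. a < t \<Longrightarrow> (P1 has_real_derivative P2 t) (at t)"
      "continuous_on {a<..} P2"
      using green_op_polynomial_smooth[where b = b and \<beta> = \<beta>, OF _ p, of \<alpha>] assms(2) unfolding W_def by auto
    obtain K where K: "0 \<le> K" "\<And>s. s \<in> {c - \<rho>..c} \<Longrightarrow> P c - P s \<le> K * (c - s) ^ 2"
    proof (rule interior_max_quadratic[of "c - \<rho>" c b P P1 P2])
      show "continuous_on {c - \<rho>..c} P2" using P(4) by (rule continuous_on_subset) (use \<rho> in auto)
      fix t assume t: "t \<in> {c - \<rho>..<b}"
      then have "W t \<le> W c" using max[of t] \<rho> by (auto simp: W_def)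
      then show "P t \<le> P c" using P(1)[of t] P(1)[of c] t \<rho> c by auto
    qed (use P \<rho> c in auto)
    \<comment> \<open>The two estimates of the second difference, divided by \<open>h\<^sup>2\<close>; now let \<open>h\<close> tend to \<open>0\<close>.\<close>
    have bound: "Gamma \<nu> * \<eta> * \<nu> \<le> 2 * K * h powr \<nu>" if h: "0 < h" "h < \<rho>" for h
    proof -
      let ?Y = "\<lambda>t. integral {a..t} (\<lambda>s. (t - s) powr (\<nu> - 1) * (m - W s))"
      have ch: "a < c - h" "c + h < b" "h < \<delta>" using h \<rho> by auto
      have G: "Gamma \<nu> * F t = m * (t - a) powr \<nu> / \<nu> - ?Y t" if "t \<in> {a..b}" for t
        unfolding F_def \<nu>_def[symmetric] using that \<nu> Wc
        by (intro rl_integral_complement) (auto elim: continuous_on_subset)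
      have "2 * ?Y c \<le> ?Y (c + h) + ?Y (c - h) + 2 * ((K * h ^ 2) * h powr \<nu> / \<nu>)"
      proof (rule kernel_second_difference)
        show "continuous_on {a..c + h} (\<lambda>s. m - W s)"
          using continuous_on_subset[OF Wc, of "{a..c + h}"] ch by (auto intro!: continuous_intros)
        fix s assume s: "s \<in> {a..c + h}"
        then show "0 \<le> m - W s" using max[of s] ch by (auto simp: W_def m_def)
      next
        fix s assume s: "s \<in> {c - h..c}"
        then have "m - W s \<le> K * (c - s) ^ 2"
          using K(2)[of s] P(1)[of s] P(1)[of c] h \<rho> c by (auto simp: m_def)
        also have "\<dots> \<le> K * h ^ 2" using s K(1) by (intro mult_left_mono power_mono) auto
        finally show "m - W s \<le> K * h ^ 2" .
      qed (use \<nu> h ch in auto)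
      moreover have "m * ((c + h - a) powr \<nu> + (c - h - a) powr \<nu>) \<le> m * (2 * (c - a) powr \<nu>)"
      proof (rule mult_left_mono)
        have "(c - a + h) powr \<nu> + (c - a - h) powr \<nu> \<le> 2 * (c - a) powr \<nu>"
          using ch h \<nu> by (intro powr_midpoint_concave) auto
        moreover have "c - a + h = c + h - a" "c - a - h = c - h - a" by auto
        ultimately show "(c + h - a) powr \<nu> + (c - h - a) powr \<nu> \<le> 2 * (c - a) powr \<nu>" by simp
      qed (use pos in \<open>auto simp: m_def W_def\<close>)
      then have "m * (c + h - a) powr \<nu> / \<nu> + m * (c - h - a) powr \<nu> / \<nu> \<le> 2 * (m * (c - a) powr \<nu> / \<nu>)"
        using \<nu>(1) by (simp add: add_divide_distrib[symmetric] divide_right_mono distrib_left mult_ac)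
      ultimately have "Gamma \<nu> * F (c + h) + Gamma \<nu> * F (c - h) - 2 * (Gamma \<nu> * F c) \<le> 2 * ((K * h ^ 2) * h powr \<nu> / \<nu>)"
        using G[of c] G[of "c + h"] G[of "c - h"] ch c h by auto
      moreover have "Gamma \<nu> * (\<eta> * h ^ 2) \<le> Gamma \<nu> * (F (c + h) + F (c - h) - 2 * F c)"
        using SD[of h] h ch \<nu> by (intro mult_left_mono) (auto simp: Gamma_real_pos less_imp_le)
      ultimately have "Gamma \<nu> * (\<eta> * h ^ 2) \<le> 2 * ((K * h ^ 2) * h powr \<nu> / \<nu>)"
        by (simp add: algebra_simps)
      then have "h ^ 2 * (Gamma \<nu> * \<eta> * \<nu>) \<le> h ^ 2 * (2 * K * h powr \<nu>)"
        using \<nu>(1) by (simp add: field_simps)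
      then show ?thesis using h by simp
    qed
    have "((\<lambda>h. 2 * K * h powr \<nu>) \<longlongrightarrow> 2 * K * 0 powr \<nu>) (at_right 0)"
      using \<nu> by (intro tendsto_intros tendsto_powr') (auto simp: eventually_at_filter)
    moreover have "\<forall>\<^sub>F h in at_right 0. Gamma \<nu> * \<eta> * \<nu> \<le> 2 * K * h powr \<nu>"
      using bound \<rho>(1) by (intro eventually_at_rightI[of 0 \<rho>]) auto
    ultimately have "Gamma \<nu> * \<eta> * \<nu> \<le> 2 * K * 0 powr \<nu>"
      by (intro tendsto_lowerbound) auto
    then show False using \<nu> \<eta> mult_pos_pos[OF mult_pos_pos[OF Gamma_real_pos[OF \<nu>(1)] \<eta>] \<nu>(1)] by simp
  qed
qed

lemma endpoint_max_linear:
  fixes P P1 :: "real \<Rightarrow> real"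
  assumes "l < b"
    and "\<And>t. t \<in> {l..b} \<Longrightarrow> (P has_real_derivative P1 t) (at t)"
    and "continuous_on {l..b} P1"
  obtains K where "0 \<le> K" "\<And>s. s \<in> {l..b} \<Longrightarrow> P b - P s \<le> K * (b - s)"
proof -
  have "bounded (P1 ` {l..b})" using assms(3) compact_imp_bounded compact_continuous_image by blast
  then obtain K where K: "\<And>t. t \<in> {l..b} \<Longrightarrow> \<bar>P1 t\<bar> \<le> K" "K > 0"
    unfolding bounded_pos by (metis imageI real_norm_def)
  have "P b - P s \<le> K * (b - s)" if s: "s \<in> {l..b}" for s
  proof (cases "s = b")
    case False
    then have "s < b" using s by simp
    have "\<exists>x. x > s \<and> x < b \<and> P b - P s = (b - s) * P1 x"
      using \<open>s < b\<close> s by (intro MVT2 assms(2)) auto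
    then obtain x where x: "s < x" "x < b" "P b - P s = (b - s) * P1 x" by blast
    then have "(b - s) * P1 x \<le> (b - s) * K"
      using K(1)[of x] s by (intro mult_left_mono) auto
    then show ?thesis using x by (simp add: mult.commute)
  qed simp
  with K(2) show thesis by (intro that[of K]) auto
qed

lemma green_op_boundary:
  assumes "a < b" "1 < \<alpha>" "\<alpha> \<le> 2" "0 \<le> \<beta>" "\<beta> \<le> \<alpha> - 1" "continuous_on {a..b} f"
  shows "(rl_integral a (1 - \<beta>) (green_op a b \<alpha> \<beta> f) has_real_derivative 0) (at b within {a..b})"
  using two_term_derivative[of \<alpha> \<beta> a b f b "green_op a b \<alpha> \<beta> f" "bvp_const a b \<alpha> \<beta> f"]
    bvp_const_eqI[of a b \<alpha> \<beta> "bvp_const a b \<alpha> \<beta> f" f] assms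
  by (simp add: green_op_def)

text \<open>
  For \<open>\<beta> = 0\<close> the boundary condition is \<open>W b = 0\<close>.  For \<open>0 < \<beta> < 1\<close> the fractional derivative
  \<open>D\<^sup>\<beta> W(b)\<close> of a function with maximum \<open>m\<close> at \<open>b\<close> is at least that of the constant \<open>m\<close>, which is
  positive.  For \<open>\<beta> = 1\<close>, hence \<open>\<alpha> = 2\<close>, the derivative \<open>W'(t) = \<integral>\<^sub>t\<^sup>b p\<close> is negative just before \<open>b\<close>.
\<close>
lemma green_op_no_endpoint_max:
  assumes "a < b" "1 < \<alpha>" "\<alpha> \<le> 2" "0 \<le> \<beta>" "\<beta> \<le> \<alpha> - 1" and p: "p = (\<lambda>s. \<Sum>i\<le>n. k i * (s - a) ^ i)"
    and max: "\<And>t. t \<in> {a..b} \<Longrightarrow> green_op a b \<alpha> \<beta> p t \<le> green_op a b \<alpha> \<beta> p b"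
    and pos: "0 < green_op a b \<alpha> \<beta> p b" and neg: "p b < 0"
  shows False
proof -
  define W where "W = green_op a b \<alpha> \<beta> p"
  define m where "m = W b"
  have m: "m > 0" using pos by (simp add: m_def W_def)
  have pc: "continuous_on {a..b} p" unfolding p by (intro continuous_intros)
  have Wc: "continuous_on {a..b} W" unfolding W_def using assms pc by (intro continuous_on_green_op)
  have at: "at b within {a..b} = at_left b" using assms(1) by (rule at_within_Icc_at_left)
  have E: "(rl_integral a (1 - \<beta>) W has_real_derivative 0) (at b within {a..b})"
    unfolding W_def using assms pc by (intro green_op_boundary)
  consider "\<beta> = 0" | "0 < \<beta>" "\<beta> < 1" | "\<beta> = 1" "\<alpha> = 2" using assms by linarith
  then show False
  proof cases
    case 1
    have G: "Gamma \<alpha> > 0" using assms by (simp add: Gamma_real_pos)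
    have "bvp_const a b \<alpha> \<beta> p * Gamma \<alpha> / Gamma \<alpha> * (b - a) powr (\<alpha> - 1) = rl_integral a \<alpha> p b"
      using bvp_const_eqI[of a b \<alpha> \<beta> "bvp_const a b \<alpha> \<beta> p" p] assms 1 by simp
    moreover have "bvp_const a b \<alpha> \<beta> p * Gamma \<alpha> / Gamma \<alpha> = bvp_const a b \<alpha> \<beta> p"
      using G by (metis less_irrefl nonzero_mult_div_cancel_right)
    ultimately show False using pos by (simp add: green_op_def)
  next
    case 2
    define \<nu> where "\<nu> = 1 - \<beta>"
    define F where "F = rl_integral a \<nu> W"
    have \<nu>: "0 < \<nu>" "\<nu> < 1" using 2 by (auto simp: \<nu>_def)
    have G\<nu>: "Gamma \<nu> > 0" using \<nu> by (simp add: Gamma_real_pos)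
    define l where "l = (a + b) / 2"
    have l: "a < l" "l < b" using assms by (auto simp: l_def)
    obtain P P1 P2 where P: "\<And>t. t \<in> {a..b} \<Longrightarrow> W t = P t"
      "\<And>t. a < t \<Longrightarrow> (P has_real_derivative P1 t) (at t)"
      "\<And>t. a < t \<Longrightarrow> (P1 has_real_derivative P2 t) (at t)"
      using green_op_polynomial_smooth[where b = b and \<beta> = \<beta>, OF _ p, of \<alpha>] assms(2) unfolding W_def
      by (metis less_trans zero_less_one)
    obtain K where K: "0 \<le> K" "\<And>s. s \<in> {l..b} \<Longrightarrow> P b - P s \<le> K * (b - s)"
    proof (rule endpoint_max_linear[of l b P P1])
      show "continuous_on {l..b} P1"
        using DERIV_isCont[OF P(3)] l by (intro continuous_at_imp_continuous_on) auto
    qed (use P l in auto)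
    \<comment> \<open>The left side is, up to \<open>Gamma \<nu>\<close>, the fractional derivative of the constant \<open>m\<close> at \<open>b\<close>.
      The difference quotient tends to \<open>0\<close> by the boundary condition.\<close>
    have bound: "m * (b - a) powr (\<nu> - 1) \<le> Gamma \<nu> * ((F t - F b) / (t - b)) + K * (b - t) powr \<nu> / \<nu>"
      if t: "t \<in> {l<..<b}" for t
    proof -
      define h where "h = b - t"
      have h: "h > 0" "t = b - h" "a \<le> b - h" "h \<le> b - a" "l \<le> b - h" using t l by (auto simp: h_def)
      let ?Y = "\<lambda>t. integral {a..t} (\<lambda>s. (t - s) powr (\<nu> - 1) * (m - W s))"
      have G: "Gamma \<nu> * F t = m * (t - a) powr \<nu> / \<nu> - ?Y t" if "t \<in> {a..b}" for t
        unfolding F_def using that \<nu> Wc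
        by (intro rl_integral_complement) (auto elim: continuous_on_subset)
      have "?Y b \<le> ?Y (b - h) + (K * h) * h powr \<nu> / \<nu>"
      proof (rule kernel_first_difference)
        show "continuous_on {a..b} (\<lambda>s. m - W s)" using Wc by (intro continuous_intros)
        show "0 \<le> m - W s" if "s \<in> {a..b}" for s using max[OF that] by (auto simp: W_def m_def)
        show "m - W s \<le> K * h" if s: "s \<in> {b - h..b}" for s
        proof -
          have "m - W s \<le> K * (b - s)"
            using K(2)[of s] P(1)[of s] P(1)[of b] h s assms by (auto simp: m_def)
          also have "\<dots> \<le> K * h" using s K(1) by (intro mult_left_mono) auto
          finally show ?thesis .
        qed
      qed (use \<nu> h in auto)
      moreover have "m * ((b - a - h) powr \<nu>) \<le> m * ((b - a) powr \<nu> - \<nu> * (b - a) powr (\<nu> - 1) * h)"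
        using assms h \<nu> m by (intro mult_left_mono powr_tangent_upper) auto
      then have "m * (b - a - h) powr \<nu> / \<nu> \<le> m * ((b - a) powr \<nu> - \<nu> * (b - a) powr (\<nu> - 1) * h) / \<nu>"
        using \<nu> by (intro divide_right_mono) auto
      then have "m * (b - h - a) powr \<nu> / \<nu> \<le> m * (b - a) powr \<nu> / \<nu> - m * (b - a) powr (\<nu> - 1) * h"
        using \<nu> by (simp add: right_diff_distrib diff_divide_distrib algebra_simps)
      ultimately have "m * (b - a) powr (\<nu> - 1) * h \<le> Gamma \<nu> * F b - Gamma \<nu> * F (b - h) + (K * h) * h powr \<nu> / \<nu>"
        using G[of b] G[of "b - h"] h assms(1) by auto
      also have "\<dots> = h * (Gamma \<nu> * ((F t - F b) / (t - b)) + K * h powr \<nu> / \<nu>)"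
        using h(1) by (simp add: h(2) field_simps)
      finally have "h * (m * (b - a) powr (\<nu> - 1)) \<le> h * (Gamma \<nu> * ((F t - F b) / (t - b)) + K * h powr \<nu> / \<nu>)"
        by (simp add: mult.commute)
      then show ?thesis using h(1) by (simp add: h_def)
    qed
    have lim1: "((\<lambda>t. (F t - F b) / (t - b)) \<longlongrightarrow> 0) (at_left b)"
      using E unfolding has_field_derivative_iff at F_def \<nu>_def .
    have lim2: "((\<lambda>t. (b - t) powr \<nu>) \<longlongrightarrow> (b - b) powr \<nu>) (at_left b)"
      using \<nu> by (intro tendsto_powr' tendsto_intros) (auto simp: eventually_at_filter)
    have "((\<lambda>t. Gamma \<nu> * ((F t - F b) / (t - b)) + K * (b - t) powr \<nu> / \<nu>)
        \<longlongrightarrow> Gamma \<nu> * 0 + K * (b - b) powr \<nu> / \<nu>) (at_left b)"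
      using \<nu> by (intro tendsto_add tendsto_mult_left tendsto_divide tendsto_const lim1 lim2) auto
    moreover have "\<forall>\<^sub>F t in at_left b. m * (b - a) powr (\<nu> - 1) \<le> Gamma \<nu> * ((F t - F b) / (t - b)) + K * (b - t) powr \<nu> / \<nu>"
      using bound l by (intro eventually_at_leftI[of l]) auto
    ultimately have "m * (b - a) powr (\<nu> - 1) \<le> Gamma \<nu> * 0 + K * (b - b) powr \<nu> / \<nu>"
      by (intro tendsto_lowerbound) auto
    moreover have "m * (b - a) powr (\<nu> - 1) > 0" using m assms by simp
    ultimately show False by simp
  next
    case 3
    have "isCont p b" unfolding p by (intro continuous_intros)
    then have "\<forall>\<^sub>F t in at b. p t < 0"
      using neg unfolding isCont_def by (intro order_tendstoD(2))
    then obtain \<delta> where \<delta>: "\<delta> > 0" "\<And>t. dist t b < \<delta> \<Longrightarrow> p t < 0"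
      using neg unfolding eventually_at by (metis UNIV_I)
    define t where "t = Max {(a + b) / 2, b - \<delta> / 2}"
    have t: "a < t" "t < b" "b - \<delta> < t" using \<delta> assms by (auto simp: t_def less_max_iff_disj)
    have W1: "(W has_real_derivative rl_integral a 1 p b - rl_integral a 1 p s) (at s within {a..b})" if "s \<in> {a<..b}" for s
    proof -
      have "bvp_const a b \<alpha> \<beta> p = rl_integral a 1 p b"
        using 3 Gamma_fact[of 1, where ?'a = real] assms(1) by (simp add: bvp_const_def)
      then show ?thesis
        using two_term_derivative[of \<alpha> \<beta> a b p s W "bvp_const a b \<alpha> \<beta> p"] that pc 3
          Gamma_fact[of 1, where ?'a = real] by (simp add: W_def green_op_def)
    qed
    have "\<exists>x\<in>{t<..<b}. W b - W t = (rl_integral a 1 p b - rl_integral a 1 p x) * (b - t)"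
    proof (rule mvt_simple[OF t(2)])
      fix x assume "t \<le> x" "x \<le> b"
      then have "(W has_real_derivative rl_integral a 1 p b - rl_integral a 1 p x) (at x within {t..b})"
        using t by (intro DERIV_subset[OF W1]) auto
      then show "(W has_derivative (*) (rl_integral a 1 p b - rl_integral a 1 p x)) (at x within {t..b})"
        by (simp add: has_field_derivative_def)
    qed
    then obtain x where x: "t < x" "x < b" "W b - W t = (rl_integral a 1 p b - rl_integral a 1 p x) * (b - t)"
      by auto
    have int: "p integrable_on {x..b}" "p integrable_on {a..b}"
      using pc x t by (auto intro!: integrable_continuous_real elim: continuous_on_subset)
    have "rl_integral a 1 p b - rl_integral a 1 p x = integral {x..b} p"
      using Henstock_Kurzweil_Integration.integral_combine[of a x b p] int x t by (simp add: rl_integral_1)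
    also have "\<dots> < 0"
    proof -
      have "integral {x..b} p < integral {x..b} (\<lambda>_. 0)"
      proof (rule integral_less_real)
        show "continuous_on {x..b} p" using pc by (rule continuous_on_subset) (use x t in auto)
        fix s assume "s \<in> {x<..<b}"
        then show "p s < 0" using \<delta>(2)[of s] x t by (auto simp: dist_real_def)
      qed (use x in auto)
      then show ?thesis by simp
    qed
    finally have "W b - W t < 0" using x t by (simp add: mult_neg_pos)
    moreover have "W t \<le> W b" using max[of t] t by (simp add: W_def)
    ultimately show False by simp
  qed
qed

lemma green_op_polynomial_nonpos:
  assumes "a < b" "1 < \<alpha>" "\<alpha> \<le> 2" "0 \<le> \<beta>" "\<beta> \<le> \<alpha> - 1" and p: "p = (\<lambda>s. \<Sum>i\<le>n. k i * (s - a) ^ i)"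
    and neg: "\<And>t. t \<in> {a..b} \<Longrightarrow> 0 < green_op a b \<alpha> \<beta> p t \<Longrightarrow> p t < 0" and t: "t \<in> {a..b}"
  shows "green_op a b \<alpha> \<beta> p t \<le> 0"
proof (rule ccontr)
  let ?W = "green_op a b \<alpha> \<beta> p"
  assume "\<not> ?W t \<le> 0"
  have "continuous_on {a..b} ?W"
    using assms(2) unfolding p by (intro continuous_on_green_op continuous_intros)
  then obtain c where c: "c \<in> {a..b}" "\<And>s. s \<in> {a..b} \<Longrightarrow> ?W s \<le> ?W c"
    using continuous_attains_sup[of "{a..b}" ?W] assms(1) by (metis atLeastAtMost_iff compact_Icc empty_iff t)
  have pos: "0 < ?W c" using c(2)[OF t] \<open>\<not> ?W t \<le> 0\<close> by simp
  have "?W a = 0" using assms(2) by (simp add: green_op_def)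
  then have "c \<noteq> a" using pos by auto
  show False
  proof (cases "c = b")
    case True
    show False
      using green_op_no_endpoint_max[OF assms(1-5) p] c pos neg[OF c(1) pos] unfolding True by blast
  next
    case False
    then have "c \<in> {a<..<b}" using c(1) \<open>c \<noteq> a\<close> by auto
    then show False
      using green_op_no_interior_max[OF assms(1-3) p, of c \<beta>] c(2) pos neg[OF c(1) pos] by blast
  qed
qed

text \<open>
  Approximating \<open>f\<close> by a polynomial strictly from below keeps the sign hypothesis and makes it strict:
  since the operator is monotone, the image of the polynomial is positive only where that of \<open>f\<close> is.
\<close>
lemma green_op_maximum_principle:
  assumes "a < b" "1 < \<alpha>" "\<alpha> \<le> 2" "0 \<le> \<beta>" "\<beta> \<le> \<alpha> - 1" "continuous_on {a..b} f"
    and neg: "\<And>t. t \<in> {a..b} \<Longrightarrow> 0 < green_op a b \<alpha> \<beta> f t \<Longrightarrow> f t \<le> 0" and t: "t \<in> {a..b}"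
  shows "green_op a b \<alpha> \<beta> f t \<le> 0"
proof -
  let ?T = "green_op a b \<alpha> \<beta>"
  have bound: "?T f t \<le> \<epsilon> * ?T (\<lambda>_. 1) t" if \<epsilon>: "\<epsilon> > 0" for \<epsilon>
  proof -
    have "continuous_on {a..b} (\<lambda>s. f s - \<epsilon> / 2)" using assms(6) by (intro continuous_intros)
    moreover have "\<epsilon> / 2 > 0" using \<epsilon> by simp
    ultimately obtain k n where kn: "\<And>x. x \<in> {a..b} \<Longrightarrow> \<bar>f x - \<epsilon> / 2 - (\<Sum>i\<le>n. k i * (x - a) ^ i)\<bar> < \<epsilon> / 2"
      by (rule shifted_polynomial_approx) blast
    define p where "p = (\<lambda>s. \<Sum>i\<le>n. k i * (s - a) ^ i)"
    have pc: "continuous_on {a..b} p" unfolding p_def by (intro continuous_intros)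
    have p: "p x < f x" "f x - \<epsilon> * 1 \<le> p x" if "x \<in> {a..b}" for x
    proof -
      have "\<bar>f x - \<epsilon> / 2 - p x\<bar> < \<epsilon> / 2" using kn[OF that] by (simp add: p_def)
      then show "p x < f x" "f x - \<epsilon> * 1 \<le> p x" by linarith+
    qed
    have "?T p t \<le> 0"
    proof (rule green_op_polynomial_nonpos[OF assms(1-5) p_def _ t])
      fix s assume s: "s \<in> {a..b}" "0 < ?T p s"
      have "?T p s \<le> ?T f s" using assms s pc p by (intro green_op_mono) (auto intro: less_imp_le)
      then show "p s < 0" using neg[OF s(1)] p(1)[OF s(1)] s by linarith
    qed
    moreover have "?T (\<lambda>s. f s - \<epsilon> * 1) t \<le> ?T p t"
      using assms pc p by (intro green_op_mono continuous_intros) auto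
    moreover have "?T (\<lambda>s. f s - \<epsilon> * 1) t = ?T f t - \<epsilon> * ?T (\<lambda>_. 1) t"
      using green_op_diff[of \<alpha> \<beta> a b f "\<lambda>s. \<epsilon> * 1" t] green_op_cmult[of a b \<alpha> \<beta> \<epsilon> "\<lambda>_. 1" t] assms by simp
    ultimately show ?thesis by linarith
  qed
  have one: "0 \<le> ?T (\<lambda>_. 1) t" using assms by (intro green_op_nonneg) auto
  show ?thesis
  proof (rule field_le_epsilon)
    fix e :: real assume e: "e > 0"
    have "e / (?T (\<lambda>_. 1) t + 1) * ?T (\<lambda>_. 1) t \<le> e" using e one by (simp add: field_simps)
    then show "?T f t \<le> 0 + e" using bound[of "e / (?T (\<lambda>_. 1) t + 1)"] e one by simp
  qed
qed

text \<open>
  The negative part of \<open>q\<close> disappears here: where \<open>u\<close> exceeds the comparison function, it is positive,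
  so \<open>q u\<close> is at most \<open>q\<^sub>+ |u|\<close>.
\<close>
lemma green_op_comparison:
  assumes "a < b" "1 < \<alpha>" "\<alpha> \<le> 2" "0 \<le> \<beta>" "\<beta> \<le> \<alpha> - 1" "continuous_on {a..b} q" "continuous_on {a..b} u"
    and u: "\<And>t. t \<in> {a..b} \<Longrightarrow> u t = green_op a b \<alpha> \<beta> (\<lambda>s. q s * u s) t" and t: "t \<in> {a..b}"
  shows "u t \<le> green_op a b \<alpha> \<beta> (\<lambda>s. max (q s) 0 * \<bar>u s\<bar>) t"
proof -
  let ?T = "green_op a b \<alpha> \<beta>" and ?f = "\<lambda>s. q s * u s" and ?g = "\<lambda>s. max (q s) 0 * \<bar>u s\<bar>"
  have c: "continuous_on {a..b} ?f" "continuous_on {a..b} ?g" using assms by (auto intro!: continuous_intros)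
  have d: "?T (\<lambda>s. ?f s - ?g s) s = u s - ?T ?g s" if "s \<in> {a..b}" for s
    using green_op_diff[of \<alpha> \<beta> a b ?f ?g s] c u[OF that] that assms by simp
  have "?T (\<lambda>s. ?f s - ?g s) t \<le> 0"
  proof (rule green_op_maximum_principle[OF assms(1-5) _ _ t])
    show "continuous_on {a..b} (\<lambda>s. ?f s - ?g s)" using c by (intro continuous_on_diff)
    fix s assume s: "s \<in> {a..b}" "0 < ?T (\<lambda>s. ?f s - ?g s) s"
    have "0 \<le> ?T ?g s" using assms c s by (intro green_op_nonneg) auto
    then have "u s > 0" using s d[OF s(1)] by simp
    then have "?f s \<le> max (q s) 0 * u s" by (intro mult_right_mono) auto
    then show "?f s - ?g s \<le> 0" using \<open>u s > 0\<close> by simp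
  qed
  then show ?thesis using d[OF t] by simp
qed

section \<open>The Lyapunov-type inequality\<close>

text \<open>
  This is the profile of the Green function along the diagonal, with \<open>x = (s - a) / (b - a)\<close>.  By
  \<open>ln z \<le> z - 1\<close>, with equality only at \<open>z = 1\<close>, the logarithm of the quotient of the two sides is
  below an expression linear in \<open>x\<close> whose terms cancel.
\<close>
lemma powr_product_less_max:
  fixes p e x :: real
  assumes "0 < p" "0 \<le> e" "0 \<le> x" "x \<le> 1" "x \<noteq> p / (p + e)"
  shows "x powr p * (if e = 0 then 1 else (1 - x) powr e)
    < (p / (p + e)) powr p * (if e = 0 then 1 else (e / (p + e)) powr e)"
proof (cases "e = 0")
  case True
  then have "x < 1" using assms by auto
  then show ?thesis using True assms powr_less_mono2[of p x 1] by simp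
next
  case False
  then have e: "e > 0" using assms by simp
  define X Y where "X = p / (p + e)" and "Y = e / (p + e)"
  have XY: "X > 0" "Y > 0" using assms e by (auto simp: X_def Y_def)
  show ?thesis
  proof (cases "x = 0 \<or> x = 1")
    case True
    then show ?thesis using e assms XY by (auto simp: X_def Y_def)
  next
    case False
    then have x: "0 < x" "x < 1" using assms by auto
    have "x \<noteq> X" using assms(5) by (simp add: X_def)
    then have "x / X > 0" "x / X \<noteq> 1" using x XY by simp_all
    then have "ln (x / X) < x / X - 1"
      using ln_le_minus_one[of "x / X"] ln_eq_minus_one[of "x / X"] by linarith
    then have 1: "p * (ln x - ln X) < p * (x / X - 1)"
      using assms(1) x XY by (simp add: ln_div)
    have "ln ((1 - x) / Y) \<le> (1 - x) / Y - 1"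
      using ln_le_minus_one[of "(1 - x) / Y"] x XY by simp
    then have 2: "e * (ln (1 - x) - ln Y) \<le> e * ((1 - x) / Y - 1)"
      using e x XY by (simp add: ln_div)
    have "p * (x / X - 1) + e * ((1 - x) / Y - 1) = 0"
      using assms(1) e by (simp add: X_def Y_def field_simps)
    with 1 2 have "p * ln x + e * ln (1 - x) < p * ln X + e * ln Y" by (simp add: algebra_simps)
    then have "exp (p * ln x + e * ln (1 - x)) < exp (p * ln X + e * ln Y)" by simp
    then have "x powr p * (1 - x) powr e < X powr p * Y powr e"
      using x XY by (simp add: powr_def exp_add)
    then show ?thesis using e by (simp add: X_def Y_def)
  qed
qed

text \<open>
  Let \<open>g\<close> be the diagonal of the Green function up to the factor \<open>Gamma \<alpha>\<close>, and \<open>gm\<close> its maximum, attained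
  only at \<open>s0\<close>.  Comparison gives \<open>Gamma \<alpha> \<le> \<integral> g q\<^sub>+\<close>, while the hypothesis gives
  \<open>gm \<sqdot> \<integral> q\<^sub>+ \<le> Gamma \<alpha>\<close>.  Hence \<open>(gm - g) q\<^sub>+\<close> is zero, so \<open>q\<^sub>+\<close> lives on the single point \<open>s0\<close>, and its
  integral cannot reach \<open>Gamma \<alpha>\<close>.
\<close>
theorem theorem4p1:
  fixes a b \<alpha> \<beta> :: real and q :: "real \<Rightarrow> real"
  assumes "a < b"
    and "1 < \<alpha>" and "\<alpha> \<le> 2"
    and "0 \<le> \<beta>" and "\<beta> \<le> \<alpha> - 1"
    and "continuous_on {a..b} q"
    and "integral {a..b} (\<lambda>t. max (q t) 0)
           \<le> Gamma \<alpha>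
              * ((2 * \<alpha> - 2 - \<beta>) / ((b - a) * (\<alpha> - 1))) powr (\<alpha> - 1)
              * (if \<beta> = \<alpha> - 1 then 1
                 else ((2 * \<alpha> - 2 - \<beta>) / (\<alpha> - 1 - \<beta>)) powr (\<alpha> - 1 - \<beta>))"
  shows "\<not> (\<exists>u. bvp_solution a b \<alpha> \<beta> q u \<and> (\<exists>t\<in>{a..b}. u t \<noteq> 0))"
proof
  assume "\<exists>u. bvp_solution a b \<alpha> \<beta> q u \<and> (\<exists>t\<in>{a..b}. u t \<noteq> 0)"
  then obtain u t1 where sol: "bvp_solution a b \<alpha> \<beta> q u" and t1: "t1 \<in> {a..b}" "u t1 \<noteq> 0" by blast
  define p e L where "p = \<alpha> - 1" and "e = \<alpha> - 1 - \<beta>" and "L = b - a"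
  define qp where "qp = (\<lambda>s. max (q s) 0)"
  define g where "g = (\<lambda>s. (s - a) powr p * endpoint_weight a b e s)"
  define gm where "gm = L powr p * ((p / (p + e)) powr p * (if e = 0 then 1 else (e / (p + e)) powr e))"
  define s0 where "s0 = a + L * (p / (p + e))"
  have pe: "0 < p" "0 \<le> e" "0 < L" using assms by (auto simp: p_def e_def L_def)
  have G: "Gamma \<alpha> > 0" using assms by (simp add: Gamma_real_pos)
  have u: "continuous_on {a..b} u" using sol by (simp add: bvp_solution_def)
  have ug: "u t = green_op a b \<alpha> \<beta> (\<lambda>s. q s * u s) t" if "t \<in> {a..b}" for t
    using bvp_solution_green_op[OF assms(1-6) sol that] .
  have abs_le: "\<bar>u t\<bar> \<le> green_op a b \<alpha> \<beta> (\<lambda>s. qp s * \<bar>u s\<bar>) t" if t: "t \<in> {a..b}" for t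
  proof -
    have "u t \<le> green_op a b \<alpha> \<beta> (\<lambda>s. qp s * \<bar>u s\<bar>) t"
      unfolding qp_def using green_op_comparison[OF assms(1-6) u ug t] .
    moreover have "- u s = green_op a b \<alpha> \<beta> (\<lambda>s. q s * - u s) s" if "s \<in> {a..b}" for s
      using green_op_cmult[of a b \<alpha> \<beta> "-1" "\<lambda>s. q s * u s" s] ug[OF that] by simp
    then have "- u t \<le> green_op a b \<alpha> \<beta> (\<lambda>s. qp s * \<bar>- u s\<bar>) t"
      unfolding qp_def using u t assms by (intro green_op_comparison[OF assms(1-6)] continuous_intros)
    ultimately show ?thesis by simp
  qed
  obtain t0 where t0: "t0 \<in> {a..b}" "\<And>t. t \<in> {a..b} \<Longrightarrow> \<bar>u t\<bar> \<le> \<bar>u t0\<bar>"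
    using continuous_attains_sup[of "{a..b}" "\<lambda>t. \<bar>u t\<bar>"] u t1
    by (metis compact_Icc continuous_on_rabs empty_iff)
  define M where "M = \<bar>u t0\<bar>"
  have M: "M > 0" using t0(2)[OF t1(1)] t1(2) by (simp add: M_def)
  have qc: "continuous_on {a..b} qp" unfolding qp_def using assms(6) by (intro continuous_intros)
  have gc: "continuous_on {a..b} g" unfolding g_def
    using pe assms(1) by (intro continuous_on_mult continuous_on_powr_shift continuous_on_endpoint_weight)
  have g0: "0 \<le> g s" if "s \<in> {a..b}" for s
    using endpoint_weight_bounds(1)[OF assms(1) pe(2) that] by (simp add: g_def)
  have gx: "g (a + L * x) = L powr p * (x powr p * (if e = 0 then 1 else (1 - x) powr e))"
    if "0 \<le> x" "x \<le> 1" for x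
  proof -
    have "(b - (a + L * x)) / (b - a) = 1 - x" using pe(3) by (simp add: L_def field_simps)
    moreover have "(L * x) powr p = L powr p * x powr p" using pe that by (simp add: powr_mult)
    ultimately show ?thesis unfolding g_def endpoint_weight_def by (simp add: mult.assoc)
  qed
  have gmax: "g s < gm" if s: "s \<in> {a..b}" "s \<noteq> s0" for s
  proof -
    define x where "x = (s - a) / L"
    have x: "0 \<le> x" "x \<le> 1" "s = a + L * x"
      using s pe(3) by (auto simp: x_def L_def field_simps)
    have "x \<noteq> p / (p + e)" using s(2) x(3) by (auto simp: s0_def)
    from powr_product_less_max[OF pe(1,2) x(1,2) this]
    show ?thesis unfolding x(3) gx[OF x(1,2)] gm_def using pe by (intro mult_strict_left_mono) auto
  qed
  have "g s0 = gm"
  proof -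
    have "1 - p / (p + e) = e / (p + e)" using pe by (simp add: field_simps)
    then show ?thesis unfolding s0_def gm_def using gx[of "p / (p + e)"] pe by simp
  qed
  then have gle: "g s \<le> gm" if "s \<in> {a..b}" for s using gmax[OF that] by (cases "s = s0") auto
  have "M \<le> 1 / Gamma \<alpha> * integral {a..b} (\<lambda>s. g s * (qp s * \<bar>u s\<bar>))"
  proof -
    have "M \<le> green_op a b \<alpha> \<beta> (\<lambda>s. qp s * \<bar>u s\<bar>) t0" unfolding M_def by (rule abs_le[OF t0(1)])
    also have "\<dots> \<le> 1 / Gamma \<alpha> * integral {a..b} (\<lambda>s. g s * (qp s * \<bar>u s\<bar>))"
      unfolding g_def p_def e_def using qc u t0(1)
      by (intro green_op_upper assms continuous_intros) (auto simp: qp_def)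
    finally show ?thesis .
  qed
  also have "\<dots> \<le> 1 / Gamma \<alpha> * integral {a..b} (\<lambda>s. M * (g s * qp s))"
  proof (intro mult_left_mono Henstock_Kurzweil_Integration.integral_le integrable_continuous_real)
    fix s assume s: "s \<in> {a..b}"
    have "g s * qp s * \<bar>u s\<bar> \<le> g s * qp s * M"
      using t0(2)[OF s] g0[OF s] by (intro mult_left_mono) (auto simp: M_def qp_def)
    then show "g s * (qp s * \<bar>u s\<bar>) \<le> M * (g s * qp s)" by (simp add: mult_ac)
  qed (use G qc gc u in \<open>auto intro!: continuous_intros\<close>)
  also have "\<dots> = M * integral {a..b} (\<lambda>s. g s * qp s) / Gamma \<alpha>" by simp
  finally have Gle: "Gamma \<alpha> \<le> integral {a..b} (\<lambda>s. g s * qp s)"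
    using M G by (simp add: field_simps)
  have "gm * integral {a..b} qp \<le> Gamma \<alpha>"
  proof -
    have gm0: "gm > 0" using pe by (auto simp: gm_def)
    have pl: "2 * \<alpha> - 2 - \<beta> = p + e" "\<alpha> - 1 - \<beta> = e" "\<alpha> - 1 = p" "b - a = L" "\<beta> = \<alpha> - 1 \<longleftrightarrow> e = 0"
      by (auto simp: p_def e_def L_def)
    define R where "R = ((p + e) / (L * p)) powr p * (if e = 0 then 1 else ((p + e) / e) powr e)"
    have "integral {a..b} qp \<le> Gamma \<alpha> * R"
      using assms(7) unfolding pl(5) unfolding pl(1,2) unfolding pl(3,4) R_def qp_def by (simp add: mult.assoc)
    then have "gm * integral {a..b} qp \<le> gm * (Gamma \<alpha> * R)" using gm0 by (intro mult_left_mono) auto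
    moreover have "gm * R = 1"
    proof -
      have "L powr p * (p / (p + e)) powr p * ((p + e) / (L * p)) powr p = 1"
        using pe by (simp add: powr_mult[symmetric])
      moreover have "(if e = 0 then 1 else (e / (p + e)) powr e) * (if e = 0 then 1 else ((p + e) / e) powr e) = 1"
        using pe by (simp add: powr_mult[symmetric])
      moreover have "gm * R = (L powr p * (p / (p + e)) powr p * ((p + e) / (L * p)) powr p) *
         ((if e = 0 then 1 else (e / (p + e)) powr e) * (if e = 0 then 1 else ((p + e) / e) powr e))"
        unfolding gm_def R_def by (simp only: mult_ac)
      ultimately show ?thesis by simp
    qed
    then have "gm * (Gamma \<alpha> * R) = Gamma \<alpha>" by (metis mult.assoc mult.commute mult.right_neutral)
    ultimately show ?thesis by simp
  qed
  have int: "(\<lambda>s. gm * qp s) integrable_on {a..b}" "(\<lambda>s. g s * qp s) integrable_on {a..b}"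
    using qc gc by (auto intro!: integrable_continuous_real continuous_intros)
  have dc: "continuous_on {a..b} (\<lambda>s. (gm - g s) * qp s)" using qc gc by (intro continuous_intros)
  have "integral {a..b} (\<lambda>s. (gm - g s) * qp s) = gm * integral {a..b} qp - integral {a..b} (\<lambda>s. g s * qp s)"
    using Henstock_Kurzweil_Integration.integral_diff[OF int] by (simp add: left_diff_distrib)
  also have "\<dots> \<le> 0" using Gle \<open>gm * integral {a..b} qp \<le> Gamma \<alpha>\<close> by simp
  finally have "integral {a..b} (\<lambda>s. (gm - g s) * qp s) \<le> 0" .
  moreover have nn: "0 \<le> (gm - g s) * qp s" if "s \<in> {a..b}" for s using gle[OF that] by (simp add: qp_def)
  then have "0 \<le> integral {a..b} (\<lambda>s. (gm - g s) * qp s)"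
    using dc by (intro Henstock_Kurzweil_Integration.integral_nonneg integrable_continuous_real)
  ultimately have "integral {a..b} (\<lambda>s. (gm - g s) * qp s) = 0" by simp
  then have zero: "(gm - g s) * qp s = 0" if "s \<in> {a..b}" for s
    using integral_eq_0_iff[OF dc assms(1)] nn that by blast
  have "integral {a..b} (\<lambda>s. g s * qp s) = integral {a..b} (\<lambda>_. 0)"
    using zero gmax by (intro integral_spike[of "{s0}"]) force+
  with Gle G show False by simp
qed

end
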